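(* Let $p,q,n$ be positive integers, $a=(-1)^{p+q-1}$, and $b\in\{1,-1\}$, with $p\neq 1$ when $b=1$, and $q\neq 1$ when $a=1$. For a positive integer $k$ put $\mathcal{H}_{k}^{(p)}(b)=\sum_{m=1}^{k}\frac{b^{m-1}}{m^p}$. Then $$\begin{aligned}\sum_{k=1}^\infty (a^n)^{k}\,\mathcal{H}_k^{(p)}(b)\sum_{j=1}^{n}\frac{a^{j-1}}{(2nk+2j-1)^q}={}&2^{-q-1}(1-(-1)^{p})\,\Phi(a,q,\tfrac12)\,\Phi(b,p,1)\\ &-a^{n-1}(-2)^{-q}n^{p}\sum_{k=0}^{\lfloor p/2\rfloor}\binom{p+q-2k-1}{q-1}n^{-2k}\,\Phi(a^nb,2k,1)\,\Phi(a,p+q-2k,\tfrac12)\\ &-\tfrac12a(-2n)^{-q}\sum_{j=1}^{n}\sum_{k=1}^{q}\binom{p+q-k-1}{p-1}a^j(-1)^{k}\,\Theta(a^nb,k,2j-1,2n)\,\Phi\!\left(b,p+q-k,\tfrac{2n-2j+1}{2n}\right).\end{aligned}$$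
   Context: Lerch function: for $c=\pm1$, integer $q\ge1$ (with $q\neq1$ if $c=1$) and $\alpha>0$, $\Phi(c,q,\alpha)=\sum_{m=0}^\infty \frac{c^m}{(m+\alpha)^q}$. At $q=0$, $\alpha=1$ the values by analytic continuation are used: $\Phi(1,0,1)=\zeta(0)=-\tfrac12$ and $\Phi(-1,0,1)=\eta(0)=\tfrac12$. For $c=\pm1$, integer $k\ge 1$ and $0<s<r$: $\Theta(c,k,s,r)=\Phi(c,k,\tfrac{s}{r})+c(-1)^{k}\Phi(c,k,\tfrac{r-s}{r})$ if $(c,k)\ne(1,1)$, and $\Theta(1,1,s,r)=\pi\cot(\pi s/r)$. *)

theory Defs
  imports "HOL-Analysis.Analysis"
begin

text \<open>
  The Lerch function, used only for \<^term>\<open>c \<in> {1, -1 :: real}\<close>. The series is the definition for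
  \<open>q \<ge> 1\<close> (and \<open>(c, q) \<noteq> (1, 1)\<close>, \<open>\<alpha> > 0\<close>), where it may converge only conditionally. For \<open>q = 0\<close> it
  does not converge and the values obtained by analytic continuation are used; they are meant for
  \<open>\<alpha> = 1\<close> only: \<open>\<zeta>(0) = -1/2\<close> for \<open>c = 1\<close> and \<open>\<eta>(0) = 1/2\<close> for \<open>c = -1\<close>.
\<close>

definition Lerch_Phi :: "real \<Rightarrow> nat \<Rightarrow> real \<Rightarrow> real" where
  "Lerch_Phi c q \<alpha> =
     (if q = 0 then (if c = 1 then - 1 / 2 else 1 / 2)
      else (\<Sum>m. c ^ m / (real m + \<alpha>) ^ q))"

definition Lerch_Theta :: "real \<Rightarrow> nat \<Rightarrow> real \<Rightarrow> real \<Rightarrow> real" where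
  "Lerch_Theta c k s r =
     (if c = 1 \<and> k = 1 then pi * cot (pi * s / r)
      else Lerch_Phi c k (s / r) + c * (-1) ^ k * Lerch_Phi c k ((r - s) / r))"

definition gen_harm :: "nat \<Rightarrow> real \<Rightarrow> nat \<Rightarrow> real" where
  "gen_harm p b k = (\<Sum>m = 1..k. b ^ (m - 1) / real m ^ p)"

end

theory Submission
  imports Defs
begin

text \<open>
  With \<open>y = (2 x + 1) / (2 n)\<close> and \<open>c = a\<^sup>n b\<close>, sum \<open>a\<^sup>x c\<^sup>m / (m\<^sup>p (y + m)\<^sup>q)\<close> over the box
  \<open>0 \<le> x < n K\<close>, \<open>0 < \<bar>m\<bar> \<le> M\<close> and let first \<open>M\<close>, then \<open>K\<close> tend to infinity.

  Summing over \<open>x\<close> first gives shifted partial sums of \<open>\<Sum>\<^sub>x a\<^sup>x / (2 x + 1)\<^sup>q\<close>. The reflection \<open>x \<mapsto> -1 - x\<close>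
  together with the parity condition on \<open>a\<close> makes the parts \<open>m > 0\<close> and \<open>m < 0\<close> add up to twice the
  series in question plus the term \<open>\<Phi>(a,q,1/2) \<Phi>(b,p,1)\<close>. The weights \<open>b\<^sup>m / m\<^sup>p\<close> and the tails of the
  partial sums are always \<open>O(1/m)\<close>, whose products are summable, so the conditionally convergent
  cases \<open>p = 1\<close> and \<open>q = 1\<close> need no separate treatment.

  Expanding \<open>1 / (m\<^sup>p (y + m)\<^sup>q)\<close> in partial fractions and summing over \<open>m\<close> first gives the two finite
  sums on the right hand side: in the powers of \<open>1/m\<close> only the even exponents survive the symmetric
  summation, and the powers of \<open>1/(y + m)\<close> produce \<open>\<Theta>\<close>, which is the symmetric bilateral sum.
\<close>

section \<open>Lerch series and their symmetric bilateral sums\<close>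

lemma summable_Lerch:
  fixes c \<alpha> :: real
  assumes "c \<in> {1, -1}" "r \<ge> 1" "c = 1 \<Longrightarrow> r \<noteq> 1" "\<alpha> > 0"
  shows "summable (\<lambda>m. c ^ m / (real m + \<alpha>) ^ r)"
proof (cases "c = 1")
  case True
  with assms have r: "r \<ge> 2" by auto
  have "summable (\<lambda>m. inverse (real (Suc m) ^ r))"
    using inverse_power_summable[OF r, where 'a = real] by (subst summable_Suc_iff)
  \<comment> \<open>After dropping the term \<open>m = 0\<close>, each denominator dominates
    \<open>real (Suc m) ^ r\<close>, however small \<alpha> is.\<close>
  have "summable (\<lambda>m. 1 / (real (Suc m) + \<alpha>) ^ r)"
  proof (rule summable_comparison_test')
    show "norm (1 / (real (Suc m) + \<alpha>) ^ r) \<le> inverse (real (Suc m) ^ r)" if "m \<ge> 0" for m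
      using assms by (auto simp: divide_simps intro!: power_mono mult_pos_pos)
  qed fact
  then show ?thesis using True by (subst (asm) summable_Suc_iff) simp
next
  case False
  then have c: "c = -1" using assms by auto
  have "summable (\<lambda>m. (-1) ^ m * (1 / (real m + \<alpha>) ^ r))"
  proof (rule summable_Leibniz'(1))
    show "(\<lambda>m. 1 / (real m + \<alpha>) ^ r) \<longlonglongrightarrow> 0"
      using assms(2) by (intro real_tendsto_divide_at_top[OF tendsto_const] filterlim_pow_at_top
          filterlim_tendsto_add_at_top[OF tendsto_const, of _ _ \<alpha>, simplified add.commute[of \<alpha>]]
          filterlim_real_sequentially) auto
    show "1 / (real (Suc m) + \<alpha>) ^ r \<le> 1 / (real m + \<alpha>) ^ r" for m
      using assms by (intro divide_left_mono power_mono mult_pos_pos zero_less_power) auto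
  qed (use assms in auto)
  then show ?thesis by (simp add: c)
qed

lemma Lerch_Phi_sums:
  assumes "c \<in> {1, -1}" "r \<ge> 1" "c = 1 \<Longrightarrow> r \<noteq> 1" "\<alpha> > 0"
  shows "(\<lambda>m. c ^ m / (real m + \<alpha>) ^ r) sums Lerch_Phi c r \<alpha>"
  using summable_sums[OF summable_Lerch[OF assms]] assms(2) by (simp add: Lerch_Phi_def)

lemma Lerch_Phi_1_sums:
  assumes "c \<in> {1, -1}" "r \<ge> 1" "c = 1 \<Longrightarrow> r \<noteq> 1"
  shows "(\<lambda>m. c ^ Suc m / real (Suc m) ^ r) sums (c * Lerch_Phi c r 1)"
  using sums_mult[OF Lerch_Phi_sums[OF assms zero_less_one], of c] by (simp add: add.commute)

text \<open>This is the logarithmic derivative of Euler's reflection formula. The formula is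
  differentiated in terms of \<open>rGamma\<close>, where it is a product without poles, and is
  first carried over from the complex to the real numbers.\<close>

lemma Digamma_reflection:
  fixes x :: real
  assumes "0 < x" "x < 1"
  shows "Digamma (1 - x) - Digamma x = pi * cot (pi * x)"
proof -
  have refl: "rGamma t * rGamma (1 - t) = sin (pi * t) / pi" for t :: real
  proof -
    have "complex_of_real (rGamma t * rGamma (1 - t)) = complex_of_real (sin (pi * t) / pi)"
      using rGamma_reflection_complex[of "of_real t"]
      using sin_of_real[of "pi * t", where 'a = complex] by (simp flip: rGamma_complex_of_real)
    then show ?thesis by (simp only: of_real_eq_iff)
  qed
  have x: "x \<notin> \<int>\<^sub>\<le>\<^sub>0" "1 - x \<notin> \<int>\<^sub>\<le>\<^sub>0"
    using assms by (auto elim!: nonpos_Ints_cases)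
  have "((\<lambda>t. rGamma t * rGamma (1 - t)) has_field_derivative
      (rGamma x * rGamma (1 - x) * (Digamma (1 - x) - Digamma x))) (at x)"
    using x by (auto intro!: derivative_eq_intros simp: algebra_simps)
  moreover have "((\<lambda>t. sin (pi * t) / pi) has_field_derivative cos (pi * x)) (at x)"
    by (auto intro!: derivative_eq_intros)
  ultimately have "sin (pi * x) / pi * (Digamma (1 - x) - Digamma x) = cos (pi * x)"
    unfolding refl by (rule DERIV_unique)
  moreover have "sin (pi * x) > 0" using assms by (intro sin_gt_zero) auto
  ultimately show ?thesis by (simp add: cot_def field_simps)
qed

text \<open>The two harmonic-type sums diverge separately. Each is compared with \<open>ln N\<close>
  by the limit formula for \<open>Digamma\<close>, and the logarithms cancel in the
  difference.\<close>

lemma cot_partial_fractions: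
  fixes x :: real
  assumes "0 < x" "x < 1"
  shows "(\<lambda>N. (\<Sum>m<N. 1 / (real m + x)) - (\<Sum>m<N. 1 / (real m + (1 - x)))) \<longlonglongrightarrow> pi * cot (pi * x)"
proof -
  have "(\<lambda>N. (of_real (ln (real N)) - (\<Sum>m<N. inverse (1 - x + of_nat m)))
      - (of_real (ln (real N)) - (\<Sum>m<N. inverse (x + of_nat m)))) \<longlonglongrightarrow> Digamma (1 - x) - Digamma x"
    using assms by (intro tendsto_diff Digamma_LIMSEQ) auto
  then show ?thesis
    by (simp add: Digamma_reflection[OF assms] field_simps inverse_eq_divide)
qed

text \<open>The symmetric partial sums of \<open>\<Sum>\<^sub>m c\<^sup>m / (y + m)\<^sup>k\<close> over all integers, using \<open>c = 1 / c\<close>.\<close>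

definition bilateral :: "real \<Rightarrow> nat \<Rightarrow> real \<Rightarrow> nat \<Rightarrow> real" where
  "bilateral c k y M = 1 / y ^ k + (\<Sum>m = 1..M. c ^ m * (1 / (y + real m) ^ k + 1 / (y - real m) ^ k))"

text \<open>Replacing \<open>y\<close> by \<open>y + 1\<close> moves the summation window -M..M by
  one index: one term enters, one leaves, and all others pick up the factor
  \<open>1 / c = c\<close>.\<close>

lemma bilateral_shift:
  assumes "c\<^sup>2 = 1"
  shows "bilateral c k (y + 1) M =
    c * bilateral c k y M + c ^ M / (y + 1 + real M) ^ k - c ^ Suc M / (y - real M) ^ k"
proof (induction M)
  case (Suc M)
  have *: "c * (c * z) = z" for z using assms by (simp add: power2_eq_square flip: mult.assoc)
  have step: "bilateral c k z (Suc M) = bilateral c k z M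
      + c ^ Suc M * (1 / (z + real (Suc M)) ^ k + 1 / (z - real (Suc M)) ^ k)" for z
    by (simp add: bilateral_def)
  have "y + 1 - real (Suc M) = y - real M" "y + real (Suc M) = y + 1 + real M" by auto
  then show ?case unfolding step Suc
    by (simp add: * distrib_left distrib_right add_ac)
qed (simp add: bilateral_def)

lemma tendsto_sign_div_power_0:
  fixes c :: real
  assumes "\<bar>c\<bar> = 1" "k \<ge> 1"
  shows "(\<lambda>M. c ^ M / (y + real M) ^ k) \<longlonglongrightarrow> 0" "(\<lambda>M. c ^ M / (y - real M) ^ k) \<longlonglongrightarrow> 0"
proof -
  have "filterlim (\<lambda>M. y + real M) at_top sequentially" for y
    by (rule filterlim_tendsto_add_at_top[OF tendsto_const filterlim_real_sequentially])
  then have lim: "(\<lambda>M. 1 / (y + real M) ^ k) \<longlonglongrightarrow> 0" for y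
    using assms(2) by (intro real_tendsto_divide_at_top[OF tendsto_const] filterlim_pow_at_top) auto
  then have *: "(\<lambda>M. \<bar>1 / (y + real M) ^ k\<bar>) \<longlonglongrightarrow> 0" for y
    by (intro tendsto_rabs_zero)
  show "(\<lambda>M. c ^ M / (y + real M) ^ k) \<longlonglongrightarrow> 0"
    by (rule tendsto_rabs_zero_cancel) (use *[of y] assms in \<open>simp add: power_abs\<close>)
  have "\<bar>y - real M\<bar> = \<bar>- y + real M\<bar>" for M by simp
  then show "(\<lambda>M. c ^ M / (y - real M) ^ k) \<longlonglongrightarrow> 0"
    using *[of "-y"] assms by (intro tendsto_rabs_zero_cancel[of "\<lambda>M. c ^ M / (y - real M) ^ k"]) (simp add: power_abs)
qed

text \<open>Induction on the integer part \<open>h\<close>: the two boundary terms in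
  \<open>bilateral_shift\<close> tend to 0, so each unit step only contributes a factor
  \<open>c\<close>. The base case splits the bilateral sum at 0.\<close>

lemma bilateral_tendsto:
  assumes c: "c \<in> {1, -1}" and k: "k \<ge> 1" and s: "0 < s" "s < r"
  shows "bilateral c k (s / r + real h) \<longlonglongrightarrow> c ^ h * Lerch_Theta c k s r"
proof (induction h)
  case 0
  define \<beta> where "\<beta> = s / r"
  have \<beta>: "0 < \<beta>" "\<beta> < 1" "1 - \<beta> = (r - s) / r" using s by (auto simp: \<beta>_def field_simps)
  have cc: "c * c = 1" using c by auto
  \<comment> \<open>The index \<open>-(m + 1)\<close> contributes
    \<open>c ^ (m + 1) / (\<beta> - (m + 1)) ^ k\<close>, which is \<open>c * (-1) ^ k\<close> times
    the \<open>m\<close>-th term of the Lerch series at \<open>1 - \<beta>\<close>.\<close>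
  have split: "bilateral c k \<beta> M = (\<Sum>m<Suc M. c ^ m / (real m + \<beta>) ^ k)
      + c * (-1) ^ k * (\<Sum>m<M. c ^ m / (real m + (1 - \<beta>)) ^ k)" for M
  proof (induction M)
    case (Suc M)
    have "(\<beta> - real (Suc M)) ^ k = (-1) ^ k * (real M + (1 - \<beta>)) ^ k"
      by (simp flip: power_mult_distrib add: algebra_simps)
    then have inv: "1 / (\<beta> - real (Suc M)) ^ k = (-1) ^ k / (real M + (1 - \<beta>)) ^ k"
      by (cases "even k") auto
    have "bilateral c k \<beta> (Suc M) = bilateral c k \<beta> M
        + c ^ Suc M * (1 / (\<beta> + real (Suc M)) ^ k + 1 / (\<beta> - real (Suc M)) ^ k)"
      by (simp add: bilateral_def)
    then show ?case unfolding Suc inv by (simp add: distrib_left add_ac)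
  qed (simp add: bilateral_def)
  show ?case
  proof (cases "c = 1 \<and> k = 1")
    case True
    \<comment> \<open>Neither half converges here. The half of nonnegative indices has one term more
      than the other; that term is split off and tends to 0, and the difference of two sums of equal
      length remains.\<close>
    have "(\<lambda>M. bilateral c k \<beta> M) \<longlonglongrightarrow> pi * cot (pi * \<beta>) + 0"
    proof (rule Lim_transform_eventually)
      show "(\<lambda>M. ((\<Sum>m<M. 1 / (real m + \<beta>)) - (\<Sum>m<M. 1 / (real m + (1 - \<beta>))))
          + 1 ^ M / (\<beta> + real M) ^ 1) \<longlonglongrightarrow> pi * cot (pi * \<beta>) + 0"
        using \<beta> by (intro tendsto_add cot_partial_fractions tendsto_sign_div_power_0) auto
    qed (use True split in \<open>auto simp: algebra_simps intro!: always_eventually\<close>)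
    then show ?thesis using True by (simp add: Lerch_Theta_def \<beta>_def)
  next
    case False
    have "(\<lambda>M. bilateral c k \<beta> M) \<longlonglongrightarrow> Lerch_Phi c k \<beta> + c * (-1) ^ k * Lerch_Phi c k (1 - \<beta>)"
      unfolding split
      using False \<beta> c k
      by (intro tendsto_intros filterlim_compose[OF _ filterlim_Suc, of "\<lambda>M. \<Sum>m<M. c ^ m / (real m + \<beta>) ^ k"]
          Lerch_Phi_sums[unfolded sums_def]) auto
    then show ?thesis using False unfolding \<beta>(3) by (auto simp: Lerch_Theta_def \<beta>_def)
  qed
next
  case (Suc h)
  define y where "y = s / r + real h"
  have "(\<lambda>M. c * bilateral c k y M + c ^ M / (y + 1 + real M) ^ k - c * (c ^ M / (y - real M) ^ k))
      \<longlonglongrightarrow> c * (c ^ h * Lerch_Theta c k s r) + 0 - c * 0"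
    using c k Suc.IH unfolding y_def by (intro tendsto_intros tendsto_sign_div_power_0) auto
  moreover have "bilateral c k (y + 1) = (\<lambda>M. c * bilateral c k y M + c ^ M / (y + 1 + real M) ^ k
      - c * (c ^ M / (y - real M) ^ k))"
    using c by (intro ext, subst bilateral_shift) auto
  ultimately have "bilateral c k (y + 1) \<longlonglongrightarrow> c ^ Suc h * Lerch_Theta c k s r"
    by (simp add: mult.assoc)
  then show ?case by (simp add: y_def add_ac)
qed

lemma Lerch_Theta_reflect:
  assumes c: "c \<in> {1, -1}" and s: "0 < s" "s < r"
  shows "Lerch_Theta c k (r - s) r = c * (-1) ^ k * Lerch_Theta c k s r"
proof (cases "c = 1 \<and> k = 1")
  case True
  have "pi * (r - s) / r = pi - pi * s / r" using s by (simp add: field_simps)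
  then show ?thesis using True by (simp add: Lerch_Theta_def cot_def)
next
  case False
  moreover have "(c * (-1) ^ k) * (c * (-1) ^ k) = 1" using c by auto
  ultimately show ?thesis by (auto simp: Lerch_Theta_def distrib_left)
qed

section \<open>Partial fractions\<close>

text \<open>Multiplying by \<^term>\<open>s = u + v\<close> turns both sides into the same Pascal-type recursion.\<close>

lemma partial_fractions_Suc:
  fixes u v s :: "'a :: field_char_0"
  assumes s: "s = u + v" and nz: "u \<noteq> 0" "v \<noteq> 0" "s \<noteq> 0"
  shows "1 / (u ^ Suc P * v ^ Suc Q) =
    (\<Sum>i\<le>P. of_nat ((i + Q) choose Q) / (s ^ Suc (i + Q) * u ^ Suc (P - i))) +
    (\<Sum>i\<le>Q. of_nat ((i + P) choose P) / (s ^ Suc (i + P) * v ^ Suc (Q - i)))"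
proof -
  define F where "F u P Q = (\<Sum>i\<le>P. of_nat ((i + Q) choose Q) / (s ^ Suc (i + Q) * u ^ Suc (P - i)))"
    for u :: 'a and P Q
  have F_rec: "s * F u (Suc P) (Suc Q) = F u P (Suc Q) + F u (Suc P) Q" for u P Q
  proof -
    have "s * F u (Suc P) (Suc Q) =
        (\<Sum>i\<le>Suc P. of_nat (Suc (i + Q) choose Suc Q) / (s ^ Suc (i + Q) * u ^ Suc (Suc P - i)))"
      unfolding F_def sum_distrib_left using nz by (intro sum.cong) auto
    also have "\<dots> = (\<Sum>i\<le>Suc P. of_nat ((i + Q) choose Suc Q) / (s ^ Suc (i + Q) * u ^ Suc (Suc P - i)))
        + F u (Suc P) Q"
      unfolding F_def by (simp add: add_divide_distrib algebra_simps flip: sum.distrib)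
    \<comment> \<open>The term \<open>i = 0\<close> has the coefficient
      \<open>Q choose Suc Q\<close>, which is 0, so the sum starts at 1 and can be shifted
      down.\<close>
    also have "(\<Sum>i\<le>Suc P. of_nat ((i + Q) choose Suc Q) / (s ^ Suc (i + Q) * u ^ Suc (Suc P - i)))
        = F u P (Suc Q)"
      unfolding F_def by (subst sum.atMost_Suc_shift) (simp add: binomial_eq_0)
    finally show ?thesis .
  qed
  \<comment> \<open>For \<open>Q = 0\<close> all coefficients are 1 and no term is lost in the
    shift. The surplus \<open>1 / u ^ Suc (Suc P)\<close> is the summand without any factor
    \<open>v\<close> that \<open>split\<close> produces in this case.\<close>
  have F_0: "s * F u (Suc P) 0 = F u P 0 + 1 / u ^ Suc (Suc P)" for u P
  proof -
    have "s * F u (Suc P) 0 = (\<Sum>i\<le>Suc P. 1 / (s ^ i * u ^ Suc (Suc P - i)))"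
      unfolding F_def sum_distrib_left using nz by (intro sum.cong) auto
    also have "\<dots> = 1 / u ^ Suc (Suc P) + F u P 0"
      unfolding F_def by (subst sum.atMost_Suc_shift) simp
    finally show ?thesis by simp
  qed
  have F_P0: "s * F u 0 (Suc Q) = F u 0 Q" for u Q
    using nz by (simp add: F_def)
  have split: "s * (1 / (u ^ Suc P * v ^ Suc Q)) = 1 / (u ^ P * v ^ Suc Q) + 1 / (u ^ Suc P * v ^ Q)" for P Q
    using nz by (simp add: s field_simps)
  have "s * (1 / (u ^ Suc P * v ^ Suc Q)) = s * (F u P Q + F v Q P)" for P Q
  proof (induction "P + Q" arbitrary: P Q)
    case 0
    have "s * F w 0 0 = 1 / w" for w using nz by (simp add: F_def)
    with 0 show ?case by (simp only: distrib_left split) simp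
  next
    case (Suc N)
    have IH: "1 / (u ^ Suc P' * v ^ Suc Q') = F u P' Q' + F v Q' P'" if "P' + Q' = N" for P' Q'
    proof -
      have "s * (1 / (u ^ Suc P' * v ^ Suc Q')) = s * (F u P' Q' + F v Q' P')"
        by (rule Suc(1)) (simp add: that)
      then show ?thesis using nz(3) by (simp only: mult_cancel_left) simp
    qed
    consider "P = 0" | "Q = 0" | P' Q' where "P = Suc P'" "Q = Suc Q'"
      by (cases P; cases Q) auto
    then show ?case
    proof cases
      case 1
      with Suc obtain Q' where "Q = Suc Q'" "0 + Q' = N" by (cases Q) auto
      with 1 show ?thesis
        using IH[of 0 Q'] by (simp only: split distrib_left F_0 F_P0) simp
    next
      case 2
      with Suc obtain P' where "P = Suc P'" "P' + 0 = N" by (cases P) auto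
      with 2 show ?thesis
        using IH[of P' 0] by (simp only: split distrib_left F_0 F_P0) simp
    next
      case 3
      with Suc show ?thesis
        using IH[of P' Q] IH[of P Q'] by (simp only: split distrib_left F_rec) simp
    qed
  qed
  then show ?thesis using nz(3) by (simp only: mult_cancel_left F_def) simp
qed

lemma partial_fractions:
  fixes u v s :: "'a :: field_char_0"
  assumes "s = u + v" "u \<noteq> 0" "v \<noteq> 0" "s \<noteq> 0" "p \<ge> 1" "q \<ge> 1"
  shows "1 / (u ^ p * v ^ q) =
    (\<Sum>i = 1..p. of_nat ((p + q - i - 1) choose (q - 1)) / (s ^ (p + q - i) * u ^ i)) +
    (\<Sum>k = 1..q. of_nat ((p + q - k - 1) choose (p - 1)) / (s ^ (p + q - k) * v ^ k))"
proof -
  obtain P Q where PQ: "p = Suc P" "q = Suc Q" using assms by (metis Suc_le_D One_nat_def)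
  \<comment> \<open>Reversing the order of summation makes the index equal to the exponent of
    \<open>w\<close>.\<close>
  have rev: "(\<Sum>i\<le>A. of_nat ((i + B) choose B) / (s ^ Suc (i + B) * w ^ Suc (A - i)))
     = (\<Sum>i = 1..Suc A. of_nat ((Suc A + Suc B - i - 1) choose B) / (s ^ (Suc A + Suc B - i) * w ^ i))"
    for w :: 'a and A B
    by (rule sum.reindex_bij_witness[of _ "\<lambda>i. Suc A - i" "\<lambda>i. Suc A - i"])
      (auto simp: Suc_diff_le add.commute[of _ B])
  show ?thesis
    using partial_fractions_Suc[OF assms(1-4), of P Q]
    unfolding rev unfolding PQ by (simp only: diff_Suc_1 add.commute[of "Suc P"])
qed

text \<open>\<open>bilateral\<close> exceeds the sum over \<open>m >= 1\<close> by
  \<open>1 / y ^ k\<close>. Multiplied by their coefficients these excess terms all carry the power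
  \<open>y ^ (p + q)\<close>, and this identity adds up their binomials.\<close>

lemma sum_binomial_hockey_stick:
  assumes "p \<ge> 1" "q \<ge> 1"
  shows "(\<Sum>k = 1..q. (p + q - k - 1) choose (p - 1)) = (p + q - 1) choose (q - 1)"
proof -
  obtain P Q where PQ: "p = Suc P" "q = Suc Q" using assms by (metis Suc_le_D One_nat_def)
  have "(\<Sum>k = 1..q. (p + q - k - 1) choose (p - 1)) = (\<Sum>k\<le>Q. (P + k) choose k)"
    unfolding PQ by (rule sum.reindex_bij_witness[of _ "\<lambda>i. Suc Q - i" "\<lambda>i. Suc Q - i"])
      (auto simp: binomial_symmetric[of P])
  also have "\<dots> = Suc (P + Q) choose Q" by (rule sum_choose_lower)
  finally show ?thesis by (simp add: PQ)
qed

text \<open>The sum over \<open>m\<close> and \<open>-m\<close>, with \<open>(-1)\<^sup>p = 1 / (-1)\<^sup>p\<close> coming from \<open>(-m)\<^sup>p\<close>.\<close>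

definition symm_kernel :: "nat \<Rightarrow> nat \<Rightarrow> real \<Rightarrow> real \<Rightarrow> nat \<Rightarrow> real" where
  "symm_kernel p q c y M =
    (\<Sum>m = 1..M. c ^ m * (1 / (real m ^ p * (y + real m) ^ q) + (-1) ^ p / (real m ^ p * (y - real m) ^ q)))"

text \<open>Partial fractions are applied with \<open>u = -m\<close>, \<open>v = y + m\<close> and
  with \<open>u = m\<close>, \<open>v = y - m\<close>; in both cases \<open>u + v = y\<close>, so
  the coefficients agree. Adding the two leaves the factor \<open>1 + (-1) ^ i\<close> at
  \<open>1 / m ^ i\<close>, which kills the odd exponents. The subtracted last term removes the
  index 0 from the bilateral sums.\<close>

lemma symm_kernel_expand:
  assumes pq: "p \<ge> 1" "q \<ge> 1" and y: "y \<noteq> 0" "\<And>m::nat. y + real m \<noteq> 0" "\<And>m::nat. y - real m \<noteq> 0"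
  shows "(-1) ^ p * symm_kernel p q c y M =
     (\<Sum>i = 1..p. real ((p + q - i - 1) choose (q - 1)) / y ^ (p + q - i) *
        ((1 + (-1) ^ i) * (\<Sum>m = 1..M. c ^ m / real m ^ i))) +
     (\<Sum>k = 1..q. real ((p + q - k - 1) choose (p - 1)) / y ^ (p + q - k) * bilateral c k y M)
     - real ((p + q - 1) choose (q - 1)) / y ^ (p + q)"
proof -
  define C where "C i = real ((p + q - i - 1) choose (q - 1)) / y ^ (p + q - i)" for i
  define C' where "C' k = real ((p + q - k - 1) choose (p - 1)) / y ^ (p + q - k)" for k
  have summand: "(-1) ^ p * (1 / (real m ^ p * (y + real m) ^ q) + (-1) ^ p / (real m ^ p * (y - real m) ^ q))
      = (\<Sum>i = 1..p. C i * ((1 + (-1) ^ i) / real m ^ i))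
      + (\<Sum>k = 1..q. C' k * (1 / (y + real m) ^ k + 1 / (y - real m) ^ k))" if "m \<ge> 1" for m
  proof -
    have m: "real m \<noteq> 0" using that by simp
    have neg: "(- real m) ^ i = (-1) ^ i * real m ^ i" for i by (rule power_minus)
    have "(-1) ^ p * (1 / (real m ^ p * (y + real m) ^ q) + (-1) ^ p / (real m ^ p * (y - real m) ^ q))
       = 1 / ((- real m) ^ p * (y + real m) ^ q) + 1 / (real m ^ p * (y - real m) ^ q)"
      unfolding neg by (cases "even p") auto
    also have "\<dots> = (\<Sum>i = 1..p. C i / (- real m) ^ i) + (\<Sum>k = 1..q. C' k / (y + real m) ^ k)
       + ((\<Sum>i = 1..p. C i / real m ^ i) + (\<Sum>k = 1..q. C' k / (y - real m) ^ k))"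
      using partial_fractions[of y "- real m" "y + real m" p q] partial_fractions[of y "real m" "y - real m" p q]
        m y pq by (simp add: C_def C'_def)
    also have "\<dots> = (\<Sum>i = 1..p. C i / (- real m) ^ i + C i / real m ^ i)
      + (\<Sum>k = 1..q. C' k / (y + real m) ^ k + C' k / (y - real m) ^ k)"
      by (simp add: sum.distrib)
    also have "(\<Sum>i = 1..p. C i / (- real m) ^ i + C i / real m ^ i) = (\<Sum>i = 1..p. C i * ((1 + (-1) ^ i) / real m ^ i))"
      unfolding neg
    proof (rule sum.cong)
      fix i
      show "C i / ((-1) ^ i * real m ^ i) + C i / real m ^ i = C i * ((1 + (-1) ^ i) / real m ^ i)"
        by (cases "even i") auto
    qed simp
    finally show ?thesis by (simp add: distrib_left)
  qed
  have "(-1) ^ p * symm_kernel p q c y M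
     = (\<Sum>m = 1..M. c ^ m * ((-1) ^ p * (1 / (real m ^ p * (y + real m) ^ q) + (-1) ^ p / (real m ^ p * (y - real m) ^ q))))"
    unfolding symm_kernel_def sum_distrib_left by (intro sum.cong) (auto simp: algebra_simps)
  also have "\<dots> = (\<Sum>m = 1..M. c ^ m * ((\<Sum>i = 1..p. C i * ((1 + (-1) ^ i) / real m ^ i))
      + (\<Sum>k = 1..q. C' k * (1 / (y + real m) ^ k + 1 / (y - real m) ^ k))))"
    by (intro sum.cong refl arg_cong2[where f = "(*)"] summand) auto
  also have "\<dots> = (\<Sum>m = 1..M. \<Sum>i = 1..p. c ^ m * (C i * ((1 + (-1) ^ i) / real m ^ i)))
      + (\<Sum>m = 1..M. \<Sum>k = 1..q. c ^ m * (C' k * (1 / (y + real m) ^ k + 1 / (y - real m) ^ k)))"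
    by (simp only: distrib_left sum.distrib sum_distrib_left)
  also have "(\<Sum>m = 1..M. \<Sum>i = 1..p. c ^ m * (C i * ((1 + (-1) ^ i) / real m ^ i)))
      = (\<Sum>i = 1..p. C i * ((1 + (-1) ^ i) * (\<Sum>m = 1..M. c ^ m / real m ^ i)))"
    unfolding sum_distrib_left by (subst sum.swap) (simp add: mult_ac)
  also have "(\<Sum>m = 1..M. \<Sum>k = 1..q. c ^ m * (C' k * (1 / (y + real m) ^ k + 1 / (y - real m) ^ k)))
      = (\<Sum>k = 1..q. C' k * (\<Sum>m = 1..M. c ^ m * (1 / (y + real m) ^ k + 1 / (y - real m) ^ k)))"
    unfolding sum_distrib_left by (subst sum.swap) (simp add: mult_ac)
  also have "\<dots> = (\<Sum>k = 1..q. C' k * bilateral c k y M) - (\<Sum>k = 1..q. C' k / y ^ k)"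
    by (simp add: bilateral_def algebra_simps flip: sum_subtractf)
  also have "(\<Sum>k = 1..q. C' k / y ^ k) = (\<Sum>k = 1..q. real ((p + q - k - 1) choose (p - 1)) / y ^ (p + q))"
    by (intro sum.cong) (auto simp: C'_def simp flip: power_add)
  also have "\<dots> = real ((p + q - 1) choose (q - 1)) / y ^ (p + q)"
    unfolding sum_divide_distrib[symmetric] of_nat_sum[symmetric] sum_binomial_hockey_stick[OF pq] ..
  finally show ?thesis by (simp add: C_def C'_def)
qed

section \<open>Double sums with harmonic decay\<close>

lemma harm_over_n_tendsto_0: "(\<lambda>n. harm n / real (Suc n)) \<longlonglongrightarrow> 0"
proof -
  have "(\<lambda>n. ((harm n - ln (real n)) * (1 / real (Suc n)) + ln (real n) / real n * (real n / real (Suc n)))) \<longlonglongrightarrow> euler_mascheroni * 0 + 0 * 1"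
    by (intro tendsto_intros euler_mascheroni_LIMSEQ lim_ln_over_n LIMSEQ_n_over_Suc_n lim_1_over_n[THEN LIMSEQ_Suc])
  moreover have "(harm n - ln (real n)) * (1 / real (Suc n)) + ln (real n) / real n * (real n / real (Suc n)) = harm n / real (Suc n)" for n
    by (cases "n = 0") (simp_all flip: add_divide_distrib)
  ultimately show ?thesis by (simp only: mult_zero_right mult_zero_left add_0)
qed

text \<open>The two factors of each denominator add up to \<open>Suc K\<close>, so every term splits
  into two reciprocals over \<open>Suc K\<close>. Both resulting sums are the harmonic number, one
  of them in reverse order.\<close>

lemma sum_reciprocal_products:
  "(\<Sum>m<K. 1 / (real (Suc m) * real (K - m))) = 2 * (harm K / real (Suc K))"
proof -
  have "(\<Sum>m<K. 1 / (real (Suc m) * real (K - m))) =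
      (\<Sum>m<K. (1 / real (Suc m) + 1 / real (Suc (K - Suc m))) / real (Suc K))"
  proof (rule sum.cong)
    fix m assume "m \<in> {..<K}"
    then have K: "Suc (K - Suc m) = K - m" "real (Suc K) = real (Suc m) + real (K - m)" "0 < real (K - m)"
      by (auto simp: of_nat_diff)
    show "1 / (real (Suc m) * real (K - m)) = (1 / real (Suc m) + 1 / real (Suc (K - Suc m))) / real (Suc K)"
      unfolding K(1,2) using K(3) by (simp add: divide_simps)
  qed simp
  also have "\<dots> = ((\<Sum>m<K. 1 / real (Suc m)) + (\<Sum>m<K. 1 / real (Suc (K - Suc m)))) / real (Suc K)"
    by (simp only: sum.distrib flip: sum_divide_distrib)
  also have "(\<Sum>m<K. 1 / real (Suc (K - Suc m))) = (\<Sum>m<K. 1 / real (Suc m))"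
    by (rule sum.nat_diff_reindex[of "\<lambda>m. 1 / real (Suc m)"])
  also have "(\<Sum>m<K. 1 / real (Suc m)) = harm K"
    unfolding harm_def by (rule sum.reindex_bij_witness[of _ "\<lambda>i. i - 1" Suc]) (auto simp: inverse_eq_divide)
  finally show ?thesis by simp
qed

text \<open>By the preceding identity the convolution of two sequences of order \<open>1 / m\<close>
  is of order \<open>log K / K\<close>.\<close>

lemma tendsto_convolution_harmonic:
  fixes v E :: "nat \<Rightarrow> real"
  assumes v: "\<And>m. \<bar>v m\<bar> \<le> 1 / real (Suc m)" and E: "\<And>m. \<bar>E m\<bar> \<le> C / real (Suc m)"
  shows "(\<lambda>K. \<Sum>m<K. v m * E (K - Suc m)) \<longlonglongrightarrow> 0"
proof (rule Lim_null_comparison)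
  have "(\<lambda>K. C * (2 * (harm K / real (Suc K)))) \<longlonglongrightarrow> C * (2 * 0)"
    by (intro tendsto_intros harm_over_n_tendsto_0)
  then show "(\<lambda>K. C * (2 * (harm K / real (Suc K)))) \<longlonglongrightarrow> 0" by simp
  have "norm (\<Sum>m<K. v m * E (K - Suc m)) \<le> C * (2 * (harm K / real (Suc K)))" for K
  proof -
    have "norm (\<Sum>m<K. v m * E (K - Suc m)) \<le> (\<Sum>m<K. C * (1 / (real (Suc m) * real (K - m))))"
    proof (rule sum_norm_le)
      fix m assume "m \<in> {..<K}"
      then have "\<bar>v m\<bar> * \<bar>E (K - Suc m)\<bar> \<le> (1 / real (Suc m)) * (C / real (K - m))"
        using E[of "K - Suc m"] by (intro mult_mono v) (auto simp: Suc_diff_Suc)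
      then show "norm (v m * E (K - Suc m)) \<le> C * (1 / (real (Suc m) * real (K - m)))"
        by (simp add: abs_mult)
    qed
    then show ?thesis by (simp only: sum_reciprocal_products flip: sum_distrib_left)
  qed
  then show "\<forall>\<^sub>F K in sequentially. norm (\<Sum>m<K. v m * E (K - Suc m)) \<le> C * (2 * (harm K / real (Suc K)))"
    by simp
qed

text \<open>The products are bounded by a multiple of \<open>1 / (m + 1) ^ 2\<close> uniformly in
  \<open>K\<close>, so Tannery's theorem allows the limit to be taken termwise, where
  \<open>E (m + K)\<close> tends to 0.\<close>

lemma tendsto_shifted_products:
  fixes v E :: "nat \<Rightarrow> real"
  assumes v: "\<And>m. \<bar>v m\<bar> \<le> A / real (Suc m)" and E: "\<And>m. \<bar>E m\<bar> \<le> B / real (Suc m)"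
  shows "summable (\<lambda>m. v m * E (m + K))" "(\<lambda>K. \<Sum>m. v m * E (m + K)) \<longlonglongrightarrow> 0"
proof -
  have AB: "A \<ge> 0" "B \<ge> 0" using v[of 0] E[of 0] by simp_all
  have bound: "norm (v m * E (m + K)) \<le> A * B * inverse (real (Suc m) ^ 2)" for m K
  proof -
    have "B / real (Suc (m + K)) \<le> B / real (Suc m)"
      using AB by (intro divide_left_mono) auto
    with E[of "m + K"] have "\<bar>E (m + K)\<bar> \<le> B / real (Suc m)" by linarith
    then have "\<bar>v m\<bar> * \<bar>E (m + K)\<bar> \<le> (A / real (Suc m)) * (B / real (Suc m))"
      using AB by (intro mult_mono v) auto
    then show ?thesis by (simp add: abs_mult power2_eq_square field_simps)
  qed
  have summ: "summable (\<lambda>m. A * B * inverse (real (Suc m) ^ 2))"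
    using inverse_power_summable[of 2, where 'a = real] by (intro summable_mult) (subst summable_Suc_iff, simp)
  show "summable (\<lambda>m. v m * E (m + K))"
    by (rule summable_comparison_test'[OF summ]) (rule bound)
  have "(\<lambda>K. B / real (Suc K)) \<longlonglongrightarrow> B * 0"
    using tendsto_mult[OF tendsto_const lim_1_over_n[THEN LIMSEQ_Suc], of B] by simp
  then have "E \<longlonglongrightarrow> 0" by (intro Lim_null_comparison[of E]) (use E in auto)
  then have "(\<lambda>K. v m * E (m + K)) \<longlonglongrightarrow> v m * 0" for m
    by (subst add.commute) (intro tendsto_mult tendsto_const LIMSEQ_ignore_initial_segment)
  then have "(\<lambda>K. \<Sum>m. v m * E (m + K)) \<longlonglongrightarrow> (\<Sum>m. v m * 0)"
    by (intro tannerys_theorem[OF _ _ summ, THEN conjunct2, THEN conjunct2] always_eventually allI) (use bound in auto)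
  then show "(\<lambda>K. \<Sum>m. v m * E (m + K)) \<longlonglongrightarrow> 0" by simp
qed

text \<open>Write \<open>G = g + E\<close>. The constant parts of the four terms tend to
  \<open>g * W\<close>, \<open>-2 * g * W\<close>, 0 and \<sigma>\<open>* g * W\<close>; the third
  is a tail of the series \<open>W\<close>, the fourth a partial sum of it. Of the parts with
  \<open>E\<close>, only the one not depending on \<open>K\<close> survives: the first and third are
  shifted products, the fourth is a convolution.\<close>

lemma symmetric_box_limit:
  fixes v G :: "nat \<Rightarrow> real"
  assumes v: "\<And>m. \<bar>v m\<bar> \<le> 1 / real (Suc m)" and W: "v sums W"
    and G0: "G 0 = 0" and G: "\<And>m. \<bar>G m - g\<bar> \<le> C / real (Suc m)"
  obtains L where
    "\<And>K. (\<lambda>m. v m * (G (Suc m + K) - 2 * G (Suc m) + G (Suc m - K) + \<sigma> * G (K - Suc m))) sums L K"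
    "L \<longlonglongrightarrow> (\<sigma> - 1) * (W * g) - 2 * (\<Sum>m. v m * (G (Suc m) - g))"
proof -
  define E where "E m = G m - g" for m
  have G_eq: "G m = g + E m" for m by (simp add: E_def)
  have E: "\<bar>E m\<bar> \<le> C / real (Suc m)" for m using G by (simp add: E_def)
  have "C \<ge> 0" using E[of 0] by simp
  have E': "\<bar>E (Suc m)\<bar> \<le> C / real (Suc m)" for m
  proof -
    have "C / real (Suc (Suc m)) \<le> C / real (Suc m)" using \<open>C \<ge> 0\<close> by (intro divide_left_mono) auto
    with E[of "Suc m"] show ?thesis by linarith
  qed
  define V where "V = (\<Sum>m. v m * E (Suc m))"
  define \<epsilon>1 where "\<epsilon>1 K = (\<Sum>m. v m * E (Suc (m + K)))" for K
  define \<epsilon>3 where "\<epsilon>3 K = (\<Sum>m. E (Suc m) * v (m + K))" for K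
  define \<epsilon>4 where "\<epsilon>4 K = (\<Sum>m<K. v m * E (K - Suc m))" for K
  define U where "U K = (\<Sum>m<K. v m)" for K
  define L where "L K = (g * W + \<epsilon>1 K) - 2 * (g * W + V) + (g * (W - U K) + \<epsilon>3 K) + \<sigma> * (g * U K + \<epsilon>4 K)" for K
  have 1: "(\<lambda>m. v m * G (Suc m + K)) sums (g * W + \<epsilon>1 K)" for K
    using sums_add[OF sums_mult[OF W, of g] summable_sums[OF tendsto_shifted_products(1)[of v 1 "\<lambda>m. E (Suc m)" C K, OF v E']]]
    by (simp add: G_eq distrib_left mult.commute \<epsilon>1_def)
  have 2: "(\<lambda>m. v m * G (Suc m)) sums (g * W + V)"
    using 1[of 0] by (simp add: \<epsilon>1_def V_def)
  \<comment> \<open>Truncated subtraction and \<open>G 0 = 0\<close> make the first \<open>K\<close>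
    terms vanish. In the remaining ones the shift falls on \<open>v\<close>, so \<open>v\<close> and
    \<open>E\<close> exchange roles.\<close>
  have 3: "(\<lambda>m. v m * G (Suc m - K)) sums (g * (W - U K) + \<epsilon>3 K)" for K
  proof -
    have "(\<lambda>m. v (m + K)) sums (W - U K)" using W unfolding U_def by (subst sums_iff_shift) simp
    from sums_add[OF sums_mult[OF this, of g]
        summable_sums[OF tendsto_shifted_products(1)[of "\<lambda>m. E (Suc m)" C v 1 K, OF E' v]]]
    have "(\<lambda>m. v (m + K) * G (Suc (m + K) - K)) sums (g * (W - U K) + \<epsilon>3 K)"
      by (simp add: G_eq distrib_left mult.commute \<epsilon>3_def Suc_diff_le)
    moreover have "(\<Sum>m<K. v m * G (Suc m - K)) = 0" by (intro sum.neutral) (auto simp: G0)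
    ultimately show ?thesis
      using sums_iff_shift[of "\<lambda>m. v m * G (Suc m - K)" K "g * (W - U K) + \<epsilon>3 K"]
      by (simp only: add_0_right)
  qed
  \<comment> \<open>Here truncation makes all terms with \<open>m >= K\<close> vanish, which leaves
    a finite convolution.\<close>
  have 4: "(\<lambda>m. v m * G (K - Suc m)) sums (g * U K + \<epsilon>4 K)" for K
  proof -
    have "(\<lambda>m. v m * G (K - Suc m)) sums (\<Sum>m<K. v m * G (K - Suc m))"
      by (intro sums_finite) (auto simp: G0)
    also have "(\<Sum>m<K. v m * G (K - Suc m)) = g * U K + \<epsilon>4 K"
      by (simp add: G_eq distrib_left sum.distrib \<epsilon>4_def U_def sum_distrib_left mult.commute)
    finally show ?thesis .
  qed
  have "(\<lambda>m. v m * (G (Suc m + K) - 2 * G (Suc m) + G (Suc m - K) + \<sigma> * G (K - Suc m))) sums L K" for K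
    using sums_add[OF sums_add[OF sums_diff[OF 1[of K] sums_mult[OF 2, of 2]] 3[of K]] sums_mult[OF 4[of K], of \<sigma>]]
    unfolding L_def by (simp add: algebra_simps)
  moreover have "L \<longlonglongrightarrow> (g * W + 0) - 2 * (g * W + V) + (g * (W - W) + 0) + \<sigma> * (g * W + 0)"
    unfolding L_def
  proof (intro tendsto_intros)
    show "\<epsilon>1 \<longlonglongrightarrow> 0" unfolding \<epsilon>1_def using tendsto_shifted_products(2)[OF v E'] by simp
    show "\<epsilon>3 \<longlonglongrightarrow> 0" unfolding \<epsilon>3_def by (rule tendsto_shifted_products(2)[OF E' v])
    show "\<epsilon>4 \<longlonglongrightarrow> 0" unfolding \<epsilon>4_def by (rule tendsto_convolution_harmonic[OF v E])
    show "U \<longlonglongrightarrow> W" using W unfolding sums_def U_def .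
    show "U \<longlonglongrightarrow> W" using W unfolding sums_def U_def .
  qed
  then have "L \<longlonglongrightarrow> (\<sigma> - 1) * (W * g) - 2 * (\<Sum>m. v m * (G (Suc m) - g))"
    by (simp add: V_def E_def algebra_simps)
  ultimately show ?thesis by (rule that)
qed

text \<open>Abel summation, with \<open>G\<close> centred at its limit \<open>g\<close> so that the
  boundary term tends to \<open>W * 0\<close>. It turns the constant left over by the box limit into
  a series of harmonic numbers times increments of \<open>G\<close>.\<close>

lemma harmonic_sum_by_parts:
  fixes v G :: "nat \<Rightarrow> real"
  assumes v: "\<And>m. \<bar>v m\<bar> \<le> 1 / real (Suc m)" and W: "v sums W"
    and G: "\<And>m. \<bar>G m - g\<bar> \<le> C / real (Suc m)"
  shows "(\<lambda>i. (\<Sum>m<Suc i. v m) * (G (Suc (Suc i)) - G (Suc i))) sums - (\<Sum>m. v m * (G (Suc m) - g))"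
proof -
  define E where "E m = G (Suc m) - g" for m
  have "C \<ge> 0" using G[of 0] by simp
  have E: "\<bar>E m\<bar> \<le> C / real (Suc m)" for m
  proof -
    have "C / real (Suc (Suc m)) \<le> C / real (Suc m)" using \<open>C \<ge> 0\<close> by (intro divide_left_mono) auto
    with G[of "Suc m"] show ?thesis unfolding E_def by linarith
  qed
  have "(\<lambda>m. C / real (Suc m)) \<longlonglongrightarrow> C * 0"
    using tendsto_mult[OF tendsto_const lim_1_over_n[THEN LIMSEQ_Suc], of C] by simp
  then have E0: "E \<longlonglongrightarrow> 0" by (intro Lim_null_comparison[of E]) (use E in auto)
  have "(\<Sum>i<N. (\<Sum>m<Suc i. v m) * (G (Suc (Suc i)) - G (Suc i)))
      = (\<Sum>m<N. v m) * E N - (\<Sum>m<N. v m * E m)" for N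
    by (induction N) (auto simp: E_def algebra_simps)
  moreover have "(\<lambda>N. (\<Sum>m<N. v m) * E N - (\<Sum>m<N. v m * E m)) \<longlonglongrightarrow> W * 0 - (\<Sum>m. v m * E m)"
    using W tendsto_shifted_products(1)[of v 1 E C 0, OF v E]
    by (intro tendsto_intros E0 summable_LIMSEQ) (auto simp: sums_def)
  ultimately show ?thesis by (simp add: sums_def E_def)
qed

section \<open>Partial sums of the series over odd numbers\<close>

text \<open>
  In the second equation the differences \<open>s - N\<close> and \<open>N - s\<close> are truncated, so that one formula covers
  both \<open>s \<le> N\<close> and \<open>N \<le> s\<close>; the same convention is used for \<open>m\<close> and \<open>K\<close> in the box sums.
\<close>

lemma reflected_partial_sums:
  fixes a :: real and q :: nat
  assumes a: "a \<in> {1, -1}"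
  defines "F \<equiv> (\<lambda>N. \<Sum>x<N. a ^ x / (2 * real x + 1) ^ q)"
  shows "(\<Sum>x<N. a ^ (x + s) / (2 * real x + 1 + 2 * real s) ^ q) = F (N + s) - F s"
    and "(\<Sum>x<N. a ^ (x + s) / (2 * real x + 1 - 2 * real s) ^ q) = a * (-1) ^ q * (F s - F (s - N)) + F (N - s)"
proof -
  show "(\<Sum>x<N. a ^ (x + s) / (2 * real x + 1 + 2 * real s) ^ q) = F (N + s) - F s"
    by (induction N) (auto simp: F_def algebra_simps)
  show "(\<Sum>x<N. a ^ (x + s) / (2 * real x + 1 - 2 * real s) ^ q) = a * (-1) ^ q * (F s - F (s - N)) + F (N - s)"
  proof (induction N)
    case (Suc N)
    show ?case
    proof (cases "s \<le> N")
      case True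
      have "a ^ (N + s) = a ^ (N - s)" using a True by (auto simp: minus_one_power_iff)
      moreover have "2 * real N + 1 - 2 * real s = 2 * real (N - s) + 1" using True by simp
      ultimately have "a ^ (N + s) / (2 * real N + 1 - 2 * real s) ^ q = a ^ (N - s) / (2 * real (N - s) + 1) ^ q"
        by (simp only:)
      moreover have "s - N = 0" "s - Suc N = 0" using True by auto
      ultimately show ?thesis
        by (simp only: sum.lessThan_Suc Suc F_def Suc_diff_le[OF True] add.assoc)
    next
      case False
      \<comment> \<open>The reflection at work: \<open>2 * N + 1 - 2 * s\<close> equals
        \<open>-(2 * d + 1)\<close>, while \<open>N + s\<close> and \<open>d\<close> have opposite
        parity. This yields the factor \<open>a * (-1) ^ q\<close>.\<close>
      then obtain d where d: "s = Suc (N + d)" using less_imp_Suc_add not_le by blast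
      have "a ^ (N + s) = a * a ^ d" using a by (auto simp: d minus_one_power_iff split: if_splits)
      moreover have "2 * real N + 1 - 2 * real s = - (2 * real d + 1)" by (simp add: d)
      moreover have "(- (2 * real d + 1)) ^ q = (-1) ^ q * (2 * real d + 1) ^ q" by (rule power_minus)
      ultimately have "a ^ (N + s) / (2 * real N + 1 - 2 * real s) ^ q = a * a ^ d / ((-1) ^ q * (2 * real d + 1) ^ q)"
        by (simp only:)
      also have "\<dots> = a * (-1) ^ q * (a ^ d / (2 * real d + 1) ^ q)"
        by (cases "even q") auto
      finally have "a ^ (N + s) / (2 * real N + 1 - 2 * real s) ^ q = a * (-1) ^ q * (a ^ d / (2 * real d + 1) ^ q)" .
      then show ?thesis using Suc by (simp add: F_def d algebra_simps)
    qed
  qed (simp add: F_def)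
qed

text \<open>For \<open>a = 1\<close> the terms are dominated by a telescoping series; for
  \<open>a = -1\<close> the error of an alternating series is at most its first omitted term. The
  second argument covers the conditionally convergent case \<open>q = 1\<close>.\<close>

lemma abs_tail_odd_powers_le:
  fixes a :: real
  assumes a: "a \<in> {1, -1}" and q: "q \<ge> 1" "a = 1 \<Longrightarrow> q \<noteq> 1"
    and S: "(\<lambda>x. a ^ x / (2 * real x + 1) ^ q) sums S"
  shows "\<bar>(\<Sum>x<N. a ^ x / (2 * real x + 1) ^ q) - S\<bar> \<le> 2 / real (Suc N)"
proof (cases "a = 1")
  case True
  define f where "f x = 1 / (2 * real x + 1) ^ q" for x
  have q2: "q \<ge> 2" using q True by auto
  have f: "0 \<le> f x" "f x \<le> 2 / real (Suc x) - 2 / real (Suc (Suc x))" for x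
  proof -
    have "(2 * real x + 1) ^ 2 \<le> (2 * real x + 1) ^ q" using q2 by (intro power_increasing) auto
    then have "f x \<le> 1 / (2 * real x + 1) ^ 2" unfolding f_def by (intro divide_left_mono) auto
    also have "\<dots> \<le> 2 / real (Suc x) - 2 / real (Suc (Suc x))"
    proof -
      \<comment> \<open>Equality holds at \<open>x = 0\<close>, which is where the constant 2 of the
        bound comes from.\<close>
      have "real (Suc x) * real (Suc (Suc x)) \<le> 2 * (2 * real x + 1) ^ 2"
        by (simp add: power2_eq_square algebra_simps)
      then have "2 / (2 * (2 * real x + 1) ^ 2) \<le> 2 / (real (Suc x) * real (Suc (Suc x)))"
        by (intro divide_left_mono) auto
      also have "\<dots> = 2 / real (Suc x) - 2 / real (Suc (Suc x))"
        by (simp add: divide_simps)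
      finally show ?thesis by simp
    qed
    finally show "f x \<le> 2 / real (Suc x) - 2 / real (Suc (Suc x))" .
  qed (simp add: f_def)
  have fS: "f sums S" using S True by (simp add: f_def[abs_def])
  have "(\<lambda>x. f (x + N)) sums (S - (\<Sum>x<N. f x))"
    using fS by (subst sums_iff_shift) simp
  moreover have "(\<lambda>x. 2 / real (Suc (x + N)) - 2 / real (Suc (Suc (x + N)))) sums (2 / real (Suc N) - 0)"
    using telescope_sums'[of "\<lambda>x. 2 / real (Suc (x + N))" 0] tendsto_mult[OF tendsto_const[of 2] LIMSEQ_ignore_initial_segment[OF lim_1_over_n, of "Suc N"]] by simp
  ultimately have "S - (\<Sum>x<N. f x) \<le> 2 / real (Suc N) - 0"
    by (rule sums_le[rotated]) (rule f)
  moreover have "(\<Sum>x<N. f x) \<le> S"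
    using fS f(1) by (metis sum_le_suminf sums_iff finite_lessThan)
  ultimately show ?thesis using True by (simp add: f_def)
next
  case False
  then have a: "a = -1" using a by auto
  define f where "f x = 1 / (2 * real x + 1) ^ q" for x
  have S_eq: "S = (\<Sum>x. (-1) ^ x * f x)" using S a by (simp add: sums_iff f_def)
  have "(\<lambda>x. 1 / (2 * real x + 1) ^ q) \<longlonglongrightarrow> 0"
    using q by (intro real_tendsto_divide_at_top[OF tendsto_const] filterlim_pow_at_top
        filterlim_tendsto_add_at_top[OF tendsto_const, of _ _ 1, unfolded add.commute[of 1]]
        filterlim_tendsto_pos_mult_at_top[OF tendsto_const] filterlim_real_sequentially) auto
  then have f0: "f \<longlonglongrightarrow> 0" unfolding f_def .
  have fpos: "f x \<ge> 0" for x by (simp add: f_def)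
  have fmono: "f (Suc x) \<le> f x" for x unfolding f_def
    by (intro divide_left_mono power_mono mult_pos_pos zero_less_power) auto
  note leib = summable_Leibniz'(2,4)[OF f0 fpos fmono]
  have le: "\<bar>(\<Sum>x<N. (-1) ^ x * f x) - S\<bar> \<le> f N"
  proof (cases "even N")
    case True
    then show ?thesis using leib[of "N div 2"] by (simp add: S_eq)
  next
    case False
    then obtain k where "N = 2 * k + 1" by (rule oddE)
    then show ?thesis using leib(2)[of k] leib(1)[of "Suc k"] by (simp add: S_eq)
  qed
  have "real (Suc N) \<le> (2 * real N + 1) ^ 1" by simp
  also have "\<dots> \<le> (2 * real N + 1) ^ q" using q by (intro power_increasing) auto
  finally have "f N \<le> 1 / real (Suc N)" unfolding f_def by (intro divide_left_mono) auto
  also have "\<dots> \<le> 2 / real (Suc N)" by (simp add: divide_right_mono)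
  finally show ?thesis using le a by (simp add: f_def)
qed

section \<open>The box sum\<close>

lemma parity_sign:
  assumes "p \<ge> 1"
  shows "(-1 :: real) ^ p = - ((-1) ^ (p + q - 1) * (-1) ^ q)"
proof -
  have "even (p + q - 1 + q) \<longleftrightarrow> odd p" using assms by presburger
  then show ?thesis unfolding power_add[symmetric] by (simp only: minus_one_power_iff) simp
qed

text \<open>With the sum over \<open>x\<close> innermost, clearing the denominator
  \<open>2 * n\<close> turns the shift of \<open>y\<close> by \<open>m\<close> into a shift of
  \<open>x\<close> by \<open>n * m\<close>, and \<open>a ^ x * a ^ (n * m)\<close> supplies the
  matching sign. The inner sums are then the reflected partial sums with
  \<open>s = n * m\<close>.\<close>

lemma box_sum_eq:
  fixes a b :: real and p q n :: nat
  assumes a: "a \<in> {1, -1}" and n: "n \<ge> 1" and apq: "a = (-1) ^ (p + q - 1)" and pq: "p \<ge> 1"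
  defines "G \<equiv> (\<lambda>u. \<Sum>x<n * u. a ^ x / (2 * real x + 1) ^ q)"
  shows "(\<Sum>x<n * K. a ^ x * symm_kernel p q (a ^ n * b) ((2 * real x + 1) / (2 * real n)) M) =
    (2 * real n) ^ q * (\<Sum>m<M. b ^ Suc m / real (Suc m) ^ p *
      (G (Suc m + K) - 2 * G (Suc m) + G (Suc m - K) + (-1) ^ p * G (K - Suc m)))"
proof -
  \<comment> \<open>The choice of \<open>a\<close> enters here: the parts from \<open>m\<close> and
    \<open>-m\<close> reinforce each other, and each contributes one \<open>- G m\<close>.\<close>
  have sgn: "(-1) ^ p * (a * (-1) ^ q) = -1"
  proof -
    have "a * (-1) ^ q = - ((-1) ^ p)" using parity_sign[OF pq, of q] by (simp add: apq)
    then show ?thesis by (simp flip: power_mult_distrib)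
  qed
  have inner: "(\<Sum>x<n * K. a ^ x * ((a ^ n * b) ^ m *
        (1 / (real m ^ p * ((2 * real x + 1) / (2 * real n) + real m) ^ q)
         + (-1) ^ p / (real m ^ p * ((2 * real x + 1) / (2 * real n) - real m) ^ q))))
      = (2 * real n) ^ q * (b ^ m / real m ^ p *
          (G (m + K) - 2 * G m + G (m - K) + (-1) ^ p * G (K - m)))" for m
  proof -
    have "a ^ x * ((a ^ n * b) ^ m *
        (1 / (real m ^ p * ((2 * real x + 1) / (2 * real n) + real m) ^ q)
         + (-1) ^ p / (real m ^ p * ((2 * real x + 1) / (2 * real n) - real m) ^ q)))
      = (2 * real n) ^ q * (b ^ m / real m ^ p *
          (a ^ (x + n * m) / (2 * real x + 1 + 2 * real (n * m)) ^ q
           + (-1) ^ p * (a ^ (x + n * m) / (2 * real x + 1 - 2 * real (n * m)) ^ q)))" for x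
    proof -
      have "(2 * real x + 1) / (2 * real n) + real m = (2 * real x + 1 + 2 * real (n * m)) / (2 * real n)"
        "(2 * real x + 1) / (2 * real n) - real m = (2 * real x + 1 - 2 * real (n * m)) / (2 * real n)"
        using n by (simp_all add: field_simps)
      then show ?thesis
        by (simp only: power_divide power_mult_distrib power_add power_mult)
          (simp add: distrib_left mult_ac del: power_divide)
    qed
    then have "(\<Sum>x<n * K. a ^ x * ((a ^ n * b) ^ m *
        (1 / (real m ^ p * ((2 * real x + 1) / (2 * real n) + real m) ^ q)
         + (-1) ^ p / (real m ^ p * ((2 * real x + 1) / (2 * real n) - real m) ^ q))))
      = (2 * real n) ^ q * (b ^ m / real m ^ p *
          ((\<Sum>x<n * K. a ^ (x + n * m) / (2 * real x + 1 + 2 * real (n * m)) ^ q)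
           + (-1) ^ p * (\<Sum>x<n * K. a ^ (x + n * m) / (2 * real x + 1 - 2 * real (n * m)) ^ q)))"
      by (simp only: sum.distrib flip: sum_distrib_left)
    also have "(\<Sum>x<n * K. a ^ (x + n * m) / (2 * real x + 1 + 2 * real (n * m)) ^ q) = G (m + K) - G m"
      unfolding reflected_partial_sums[OF a] G_def by (simp add: distrib_left add.commute)
    also have "(-1) ^ p * (\<Sum>x<n * K. a ^ (x + n * m) / (2 * real x + 1 - 2 * real (n * m)) ^ q)
        = ((-1) ^ p * (a * (-1) ^ q)) * (G m - G (m - K)) + (-1) ^ p * G (K - m)"
      unfolding reflected_partial_sums[OF a] G_def by (simp add: algebra_simps)
    finally show ?thesis unfolding sgn by (simp add: algebra_simps)
  qed
  have "(\<Sum>x<n * K. a ^ x * symm_kernel p q (a ^ n * b) ((2 * real x + 1) / (2 * real n)) M)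
      = (\<Sum>m = 1..M. \<Sum>x<n * K. a ^ x * ((a ^ n * b) ^ m *
        (1 / (real m ^ p * ((2 * real x + 1) / (2 * real n) + real m) ^ q)
         + (-1) ^ p / (real m ^ p * ((2 * real x + 1) / (2 * real n) - real m) ^ q))))"
    unfolding symm_kernel_def sum_distrib_left by (rule sum.swap)
  also have "\<dots> = (\<Sum>m = 1..M. (2 * real n) ^ q * (b ^ m / real m ^ p *
          (G (m + K) - 2 * G m + G (m - K) + (-1) ^ p * G (K - m))))"
    by (simp only: inner)
  also have "\<dots> = (\<Sum>m<M. (2 * real n) ^ q * (b ^ Suc m / real (Suc m) ^ p *
          (G (Suc m + K) - 2 * G (Suc m) + G (Suc m - K) + (-1) ^ p * G (K - Suc m))))"
    by (rule sum.reindex_bij_witness[of _ Suc "\<lambda>i. i - 1"]) auto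
  finally show ?thesis by (simp only: sum_distrib_left)
qed

text \<open>
  The summand \<open>i = 0\<close>, for which \<open>2 c \<Phi>(c,0,1) = -1\<close> by the values at \<open>q = 0\<close>, stands for the missing
  term \<open>m = 0\<close> of the bilateral sums.
\<close>

lemma symm_kernel_tendsto:
  fixes c :: real and p q n x :: nat
  assumes c: "c \<in> {1, -1}" and pq: "p \<ge> 1" "q \<ge> 1" and n: "n \<ge> 1"
  defines "y \<equiv> (2 * real x + 1) / (2 * real n)"
  shows "symm_kernel p q c y \<longlonglongrightarrow> (-1) ^ p *
    ((\<Sum>i = 0..p. real ((p + q - i - 1) choose (q - 1)) / y ^ (p + q - i) *
        ((1 + (-1) ^ i) * (c * Lerch_Phi c i 1))) +
     (\<Sum>k = 1..q. real ((p + q - k - 1) choose (p - 1)) / y ^ (p + q - k) *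
        (c ^ (x div n) * Lerch_Theta c k (2 * real (x mod n) + 1) (2 * real n))))"
proof -
  \<comment> \<open>The residue of \<open>x\<close> modulo \<open>n\<close> gives the fractional
    part of \<open>y\<close>, the quotient its integer part, as \<open>bilateral_tendsto\<close>
    requires.\<close>
  have y_eq: "y = (2 * real (x mod n) + 1) / (2 * real n) + real (x div n)"
  proof -
    have "real x = real n * real (x div n) + real (x mod n)"
      by (metis mult_div_mod_eq of_nat_add of_nat_mult)
    then show ?thesis using n by (simp add: y_def field_simps)
  qed
  \<comment> \<open>An odd number is never \<open>2 * n * m\<close>, so \<open>y\<close> avoids the
    poles at the integers.\<close>
  have odd: "2 * real x + 1 \<noteq> 2 * real k" for k
  proof
    assume "2 * real x + 1 = 2 * real k"
    then have "real (2 * x + 1) = real (2 * k)" by simp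
    then show False unfolding of_nat_eq_iff by presburger
  qed
  have y: "y \<noteq> 0" "y + real m \<noteq> 0" "y - real m \<noteq> 0" for m
  proof -
    have "y > 0" using n by (simp add: y_def)
    then show "y \<noteq> 0" "y + real m \<noteq> 0" by linarith+
    show "y - real m \<noteq> 0" using odd[of "m * n"] n by (simp add: y_def field_simps)
  qed
  have "real (x mod n) \<le> real n - 1" using n mod_less_divisor[of n x]
    by (metis One_nat_def Suc_leI Suc_le_lessD le_diff_conv2 of_nat_1 of_nat_diff of_nat_le_iff Suc_eq_plus1)
  then have bil: "bilateral c k y \<longlonglongrightarrow> c ^ (x div n) * Lerch_Theta c k (2 * real (x mod n) + 1) (2 * real n)"
    if "k \<ge> 1" for k unfolding y_eq using c that by (intro bilateral_tendsto) auto
  \<comment> \<open>For odd \<open>i\<close> the factor \<open>1 + (-1) ^ i\<close> is 0, so the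
    possibly divergent series with \<open>i = 1\<close> never has to be summed.\<close>
  have phi: "(\<lambda>M. (1 + (-1) ^ i) * (\<Sum>m = 1..M. c ^ m / real m ^ i)) \<longlonglongrightarrow> (1 + (-1) ^ i) * (c * Lerch_Phi c i 1)"
    if "i \<ge> 1" for i
  proof (cases "even i")
    case True
    then have "i \<noteq> 1" by auto
    have "(\<Sum>m = 1..M. c ^ m / real m ^ i) = (\<Sum>m<M. c ^ Suc m / real (Suc m) ^ i)" for M
      by (rule sum.reindex_bij_witness[of _ Suc "\<lambda>i. i - 1"]) auto
    then show ?thesis
      using Lerch_Phi_1_sums[OF c that] \<open>i \<noteq> 1\<close> by (intro tendsto_intros) (simp add: sums_def)
  qed simp
  have "(\<lambda>M. (-1) ^ p * symm_kernel p q c y M) \<longlonglongrightarrow>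
     (\<Sum>i = 1..p. real ((p + q - i - 1) choose (q - 1)) / y ^ (p + q - i) *
        ((1 + (-1) ^ i) * (c * Lerch_Phi c i 1))) +
     (\<Sum>k = 1..q. real ((p + q - k - 1) choose (p - 1)) / y ^ (p + q - k) *
        (c ^ (x div n) * Lerch_Theta c k (2 * real (x mod n) + 1) (2 * real n)))
     - real ((p + q - 1) choose (q - 1)) / y ^ (p + q)"
    unfolding symm_kernel_expand[OF pq y]
    by (intro tendsto_diff tendsto_add tendsto_sum tendsto_mult[OF tendsto_const] tendsto_const phi bil) auto
  also have "(\<Sum>i = 1..p. real ((p + q - i - 1) choose (q - 1)) / y ^ (p + q - i) *
        ((1 + (-1) ^ i) * (c * Lerch_Phi c i 1)))
     = (\<Sum>i = 0..p. real ((p + q - i - 1) choose (q - 1)) / y ^ (p + q - i) *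
        ((1 + (-1) ^ i) * (c * Lerch_Phi c i 1))) + real ((p + q - 1) choose (q - 1)) / y ^ (p + q)"
    using c by (subst (2) sum.atLeast_Suc_atMost) (auto simp: Lerch_Phi_def)
  finally have "(\<lambda>M. (-1) ^ p * ((-1) ^ p * symm_kernel p q c y M)) \<longlonglongrightarrow> (-1) ^ p *
    ((\<Sum>i = 0..p. real ((p + q - i - 1) choose (q - 1)) / y ^ (p + q - i) *
        ((1 + (-1) ^ i) * (c * Lerch_Phi c i 1))) +
     (\<Sum>k = 1..q. real ((p + q - k - 1) choose (p - 1)) / y ^ (p + q - k) *
        (c ^ (x div n) * Lerch_Theta c k (2 * real (x mod n) + 1) (2 * real n))))"
    by (intro tendsto_mult[OF tendsto_const]) simp
  moreover have "(-1) ^ p * ((-1) ^ p * z) = z" for z :: real by (cases "even p") auto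
  ultimately show ?thesis by simp
qed

section \<open>Limits over the number \<open>K\<close> of blocks\<close>

lemma filterlim_mult_nat_at_top: "n \<ge> (1 :: nat) \<Longrightarrow> filterlim (\<lambda>K. n * K) at_top sequentially"
  by (rule filterlim_subseq) (auto simp: strict_mono_def)

lemma half_integer_sums_tendsto:
  fixes a :: real and n r :: nat
  assumes "a \<in> {1, -1}" "r \<ge> 1" "a = 1 \<Longrightarrow> r \<noteq> 1" and n: "n \<ge> 1"
  shows "(\<lambda>K. \<Sum>x<n * K. a ^ x * (1 / ((2 * real x + 1) / (2 * real n)) ^ r))
    \<longlonglongrightarrow> real n ^ r * Lerch_Phi a r (1 / 2)"
proof -
  have eq: "a ^ x * (1 / ((2 * real x + 1) / (2 * real n)) ^ r) = real n ^ r * (a ^ x / (real x + 1 / 2) ^ r)" for x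
  proof -
    have "(2 * real x + 1) / (2 * real n) = (real x + 1 / 2) / real n" using n by (simp add: field_simps)
    then show ?thesis by (simp add: power_divide)
  qed
  have "(\<lambda>x. real n ^ r * (a ^ x / (real x + 1 / 2) ^ r)) sums (real n ^ r * Lerch_Phi a r (1 / 2))"
    using assms by (intro sums_mult Lerch_Phi_sums) auto
  then show ?thesis unfolding eq sums_def
    by (rule filterlim_compose[OF _ filterlim_mult_nat_at_top[OF n]])
qed

text \<open>Group the indices as \<open>x = k * n + j\<close>. The signs \<open>a ^ (k * n)\<close>
  from both factors cancel, so each residue class \<open>j\<close> carries a Lerch series with sign
  \<open>b\<close>.\<close>

lemma grouped_sums_tendsto:
  fixes a b :: real and n r :: nat
  assumes a: "a \<in> {1, -1}" and b: "b \<in> {1, -1}" and r: "r \<ge> 1" "b = 1 \<Longrightarrow> r \<noteq> 1" and n: "n \<ge> 1"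
  shows "(\<lambda>K. \<Sum>x<n * K. a ^ x * (1 / ((2 * real x + 1) / (2 * real n)) ^ r * ((a ^ n * b) ^ (x div n) * \<theta> (x mod n))))
    \<longlonglongrightarrow> (\<Sum>j<n. a ^ j * \<theta> j * Lerch_Phi b r ((2 * real j + 1) / (2 * real n)))"
proof -
  define f where "f x = a ^ x * (1 / ((2 * real x + 1) / (2 * real n)) ^ r * ((a ^ n * b) ^ (x div n) * \<theta> (x mod n)))" for x
  have f: "f (k * n + j) = a ^ j * \<theta> j * (b ^ k / (real k + (2 * real j + 1) / (2 * real n)) ^ r)" if "j < n" for k j
  proof -
    have "(2 * real (k * n + j) + 1) / (2 * real n) = real k + (2 * real j + 1) / (2 * real n)"
      using n by (simp add: field_simps)
    moreover have "(k * n + j) div n = k" "(k * n + j) mod n = j" using that by auto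
    moreover have "a ^ (k * n + j) * (a ^ n * b) ^ k = a ^ j * b ^ k"
    proof -
      have "a ^ (k * n) * a ^ (n * k) = 1" using a by (auto simp: mult.commute simp flip: power_mult_distrib)
      then show ?thesis by (simp add: power_add power_mult_distrib mult_ac flip: power_mult)
    qed
    ultimately show ?thesis by (simp add: f_def field_simps)
  qed
  have "(\<Sum>x<n * K. f x) = (\<Sum>j<n. a ^ j * \<theta> j * (\<Sum>k<K. b ^ k / (real k + (2 * real j + 1) / (2 * real n)) ^ r))" for K
  proof -
    have "(\<Sum>x<n * K. f x) = (\<Sum>k<K. \<Sum>x = k * n..<k * n + n. f x)"
      by (simp add: sum.nat_group mult.commute)
    also have "\<dots> = (\<Sum>k<K. \<Sum>j<n. f (k * n + j))"
    proof (rule sum.cong)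
      show "(\<Sum>x = k * n..<k * n + n. f x) = (\<Sum>j<n. f (k * n + j))" for k
        by (rule sum.reindex_bij_witness[of _ "\<lambda>j. k * n + j" "\<lambda>x. x - k * n"]) auto
    qed simp
    also have "\<dots> = (\<Sum>k<K. \<Sum>j<n. a ^ j * \<theta> j * (b ^ k / (real k + (2 * real j + 1) / (2 * real n)) ^ r))"
      by (intro sum.cong refl f) simp
    finally show ?thesis unfolding sum_distrib_left by (subst sum.swap)
  qed
  moreover have "(\<lambda>K. \<Sum>j<n. a ^ j * \<theta> j * (\<Sum>k<K. b ^ k / (real k + (2 * real j + 1) / (2 * real n)) ^ r))
     \<longlonglongrightarrow> (\<Sum>j<n. a ^ j * \<theta> j * Lerch_Phi b r ((2 * real j + 1) / (2 * real n)))"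
    using b r n by (intro tendsto_sum tendsto_mult[OF tendsto_const] Lerch_Phi_sums[unfolded sums_def]) auto
  ultimately show ?thesis by (simp add: f_def)
qed

lemma sum_even_terms:
  fixes h :: "nat \<Rightarrow> real"
  shows "(\<Sum>i = 0..p. (1 + (-1) ^ i) * h i) = 2 * (\<Sum>k = 0..p div 2. h (2 * k))"
proof -
  have "(\<Sum>i = 0..p. (1 + (-1) ^ i) * h i) = (\<Sum>i \<in> (\<lambda>k. 2 * k) ` {0..p div 2}. 2 * h i)"
  proof (rule sum.mono_neutral_cong_right)
    show "\<forall>i \<in> {0..p} - (\<lambda>k. 2 * k) ` {0..p div 2}. (1 + (-1) ^ i) * h i = 0"
    proof
      fix i assume "i \<in> {0..p} - (\<lambda>k. 2 * k) ` {0..p div 2}"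
      then have "odd i" by (auto elim!: evenE)
      then show "(1 + (-1) ^ i) * h i = 0" by simp
    qed
  qed auto
  also have "\<dots> = (\<Sum>k = 0..p div 2. 2 * h (2 * k))"
    by (subst sum.reindex) (auto simp: inj_on_def)
  finally show ?thesis by (simp add: sum_distrib_left)
qed

text \<open>The first equation compares the two evaluations of the iterated limit, by
  \<open>symmetric_box_limit\<close> and by partial fractions. The second identifies the infinite
  sum occurring in it with the series of the theorem, up to the factor \<open>b\<close>.\<close>

lemma box_limit_values:
  fixes a b :: real and p q n :: nat
  assumes pq: "p \<ge> 1" "q \<ge> 1" and n: "n \<ge> 1" and a: "a = (-1) ^ (p + q - 1)"
    and b: "b \<in> {1, -1}" "b = 1 \<Longrightarrow> p \<noteq> 1" and q1: "a = 1 \<Longrightarrow> q \<noteq> 1"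
  defines "c \<equiv> a ^ n * b" and "g \<equiv> Lerch_Phi a q (1 / 2) / 2 ^ q"
    and "G \<equiv> (\<lambda>u. \<Sum>x<n * u. a ^ x / (2 * real x + 1) ^ q)"
  shows "(2 * real n) ^ q * (((-1) ^ p - 1) * (b * Lerch_Phi b p 1 * g)
        - 2 * (\<Sum>m. b ^ Suc m / real (Suc m) ^ p * (G (Suc m) - g)))
    = (-1) ^ p * ((\<Sum>i = 0..p. real ((p + q - i - 1) choose (q - 1)) * (1 + (-1) ^ i) * (c * Lerch_Phi c i 1) *
          (real n ^ (p + q - i) * Lerch_Phi a (p + q - i) (1 / 2)))
      + (\<Sum>k = 1..q. real ((p + q - k - 1) choose (p - 1)) *
          (\<Sum>j<n. a ^ j * Lerch_Theta c k (2 * real j + 1) (2 * real n) *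
             Lerch_Phi b (p + q - k) ((2 * real j + 1) / (2 * real n)))))" (is "_ = ?T")
    and "(\<lambda>i. (\<Sum>m<Suc i. b ^ Suc m / real (Suc m) ^ p) * (G (Suc (Suc i)) - G (Suc i)))
      sums - (\<Sum>m. b ^ Suc m / real (Suc m) ^ p * (G (Suc m) - g))"
proof -
  have a1: "a \<in> {1, -1}" unfolding a by (cases "even (p + q - 1)") auto
  have c1: "c \<in> {1, -1}" using a1 b(1) unfolding c_def by (cases "even n") auto
  define v where "v m = b ^ Suc m / real (Suc m) ^ p" for m
  have v: "\<bar>v m\<bar> \<le> 1 / real (Suc m)" for m
  proof -
    have "real (Suc m) ^ 1 \<le> real (Suc m) ^ p" using pq by (intro power_increasing) auto
    moreover have "\<bar>v m\<bar> = 1 / real (Suc m) ^ p" using b by (auto simp: v_def power_abs abs_mult)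
    ultimately show ?thesis by (auto intro!: divide_left_mono simp del: of_nat_Suc)
  qed
  have W: "v sums (b * Lerch_Phi b p 1)"
    unfolding v_def using b pq by (intro Lerch_Phi_1_sums) auto
  have g: "(\<lambda>x. a ^ x / (2 * real x + 1) ^ q) sums g"
  proof -
    have "2 * real x + 1 = 2 * (real x + 1 / 2)" for x by simp
    then have "a ^ x / (2 * real x + 1) ^ q = (a ^ x / (real x + 1 / 2) ^ q) / 2 ^ q" for x
      by (simp only: power_mult_distrib) simp
    moreover have "(\<lambda>x. (a ^ x / (real x + 1 / 2) ^ q) / 2 ^ q) sums g"
      unfolding g_def using a1 pq q1 by (intro sums_divide Lerch_Phi_sums) auto
    ultimately show ?thesis by (simp only:)
  qed
  have G: "\<bar>G m - g\<bar> \<le> 2 / real (Suc m)" for m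
  proof -
    have "\<bar>G m - g\<bar> \<le> 2 / real (Suc (n * m))"
      unfolding G_def by (rule abs_tail_odd_powers_le[OF a1 pq(2) q1 g])
    also have "\<dots> \<le> 2 / real (Suc m)"
    proof (rule divide_left_mono)
      have "m \<le> n * m" using n by simp
      then show "real (Suc m) \<le> real (Suc (n * m))" by (simp only: of_nat_le_iff Suc_le_mono)
    qed (auto intro!: mult_pos_pos simp del: of_nat_Suc)
    finally show ?thesis .
  qed
  have G0: "G 0 = 0" by (simp add: G_def)
  show "(\<lambda>i. (\<Sum>m<Suc i. b ^ Suc m / real (Suc m) ^ p) * (G (Suc (Suc i)) - G (Suc i)))
      sums - (\<Sum>m. b ^ Suc m / real (Suc m) ^ p * (G (Suc m) - g))"
    using harmonic_sum_by_parts[OF v W G] unfolding v_def .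
  obtain L where
    L: "\<And>K. (\<lambda>m. v m * (G (Suc m + K) - 2 * G (Suc m) + G (Suc m - K) + (-1) ^ p * G (K - Suc m))) sums L K"
    and L_lim: "L \<longlonglongrightarrow> ((-1) ^ p - 1) * (b * Lerch_Phi b p 1 * g) - 2 * (\<Sum>m. v m * (G (Suc m) - g))"
    using symmetric_box_limit[OF v W G0 G, of "(-1) ^ p"] by blast
  define y where "y x = (2 * real x + 1) / (2 * real n)" for x
  define D where "D x = (-1) ^ p *
    ((\<Sum>i = 0..p. real ((p + q - i - 1) choose (q - 1)) / y x ^ (p + q - i) *
        ((1 + (-1) ^ i) * (c * Lerch_Phi c i 1))) +
     (\<Sum>k = 1..q. real ((p + q - k - 1) choose (p - 1)) / y x ^ (p + q - k) *
        (c ^ (x div n) * Lerch_Theta c k (2 * real (x mod n) + 1) (2 * real n))))" for x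
  \<comment> \<open>For fixed \<open>K\<close> both sides are the limit of the same box sum as
    \<open>M\<close> grows; \<open>K\<close> is sent to infinity only afterwards.\<close>
  have LD: "(2 * real n) ^ q * L K = (\<Sum>x<n * K. a ^ x * D x)" for K
  proof (rule LIMSEQ_unique)
    show "(\<lambda>M. \<Sum>x<n * K. a ^ x * symm_kernel p q c (y x) M) \<longlonglongrightarrow> (\<Sum>x<n * K. a ^ x * D x)"
      unfolding D_def y_def by (intro tendsto_sum tendsto_mult[OF tendsto_const] symm_kernel_tendsto c1 pq n)
    show "(\<lambda>M. \<Sum>x<n * K. a ^ x * symm_kernel p q c (y x) M) \<longlonglongrightarrow> (2 * real n) ^ q * L K"
      unfolding y_def c_def box_sum_eq[OF a1 n a pq(1)]
      using L[of K] unfolding v_def G_def by (intro tendsto_mult[OF tendsto_const]) (simp only: sums_def)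
  qed
  have sum_D: "(\<Sum>x<N. a ^ x * D x) = (-1) ^ p *
     ((\<Sum>i = 0..p. real ((p + q - i - 1) choose (q - 1)) * (1 + (-1) ^ i) * (c * Lerch_Phi c i 1) *
          (\<Sum>x<N. a ^ x * (1 / y x ^ (p + q - i))))
      + (\<Sum>k = 1..q. real ((p + q - k - 1) choose (p - 1)) *
          (\<Sum>x<N. a ^ x * (1 / y x ^ (p + q - k) *
             (c ^ (x div n) * Lerch_Theta c k (2 * real (x mod n) + 1) (2 * real n))))))" for N
  proof -
    have swap: "(\<Sum>i\<in>I. C i * (\<Sum>x<N. f i x)) = (\<Sum>x<N. \<Sum>i\<in>I. C i * f i x)"
      for C :: "nat \<Rightarrow> real" and f :: "nat \<Rightarrow> nat \<Rightarrow> real" and I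
      unfolding sum_distrib_left by (rule sum.swap)
    show ?thesis unfolding swap
      by (simp add: D_def sum_distrib_left distrib_left distrib_right add_divide_distrib sum.distrib mult_ac)
  qed
  have "(\<lambda>K. \<Sum>x<n * K. a ^ x * D x) \<longlonglongrightarrow> ?T"
    unfolding sum_D y_def c_def
  proof (intro tendsto_mult[OF tendsto_const] tendsto_add tendsto_sum)
    \<comment> \<open>The exponent \<open>p + q - i\<close> is at least \<open>q\<close>, and in the
      second sum \<open>p + q - k\<close> is at least \<open>p\<close>, so the conditions on
      \<open>q\<close> and \<open>p\<close> exclude all divergent series.\<close>
    fix i assume "i \<in> {0..p}"
    moreover have "q \<noteq> 1" if "a = 1" using q1 that by simp
    ultimately show "(\<lambda>K. \<Sum>x<n * K. a ^ x * (1 / ((2 * real x + 1) / (2 * real n)) ^ (p + q - i)))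
        \<longlonglongrightarrow> real n ^ (p + q - i) * Lerch_Phi a (p + q - i) (1 / 2)"
      using pq by (intro half_integer_sums_tendsto a1 n) auto
  next
    fix k assume "k \<in> {1..q}"
    then show "(\<lambda>K. \<Sum>x<n * K. a ^ x * (1 / ((2 * real x + 1) / (2 * real n)) ^ (p + q - k) *
          ((a ^ n * b) ^ (x div n) * Lerch_Theta (a ^ n * b) k (2 * real (x mod n) + 1) (2 * real n))))
        \<longlonglongrightarrow> (\<Sum>j<n. a ^ j * Lerch_Theta (a ^ n * b) k (2 * real j + 1) (2 * real n) *
             Lerch_Phi b (p + q - k) ((2 * real j + 1) / (2 * real n)))"
      using pq b by (intro grouped_sums_tendsto[where \<theta> = "\<lambda>j. Lerch_Theta (a ^ n * b) k (2 * real j + 1) (2 * real n)"] a1 b(1) n) auto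
  qed
  moreover have "(\<lambda>K. \<Sum>x<n * K. a ^ x * D x) \<longlonglongrightarrow> (2 * real n) ^ q *
      (((-1) ^ p - 1) * (b * Lerch_Phi b p 1 * g) - 2 * (\<Sum>m. v m * (G (Suc m) - g)))"
    unfolding LD[symmetric] by (intro tendsto_mult[OF tendsto_const] L_lim)
  ultimately show "(2 * real n) ^ q * (((-1) ^ p - 1) * (b * Lerch_Phi b p 1 * g)
        - 2 * (\<Sum>m. b ^ Suc m / real (Suc m) ^ p * (G (Suc m) - g))) = ?T"
    unfolding v_def using LIMSEQ_unique by blast
qed

section \<open>Reversal of the residue classes and assembly of the formula\<close>

text \<open>The substitution of \<open>n - j\<close> for \<open>j\<close> is combined with the
  reflection of \<open>Lerch_Theta\<close>. The signs collapse through
  \<open>a ^ (n - j) * c = b * a ^ j\<close>, so that a single factor \<open>b\<close> comes out of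
  the sum.\<close>

lemma reflected_Theta_sum:
  fixes a b :: real and n k :: nat
  assumes a: "a \<in> {1, -1}" and b: "b \<in> {1, -1}"
  defines "c \<equiv> a ^ n * b"
  shows "(\<Sum>j<n. a ^ j * Lerch_Theta c k (2 * real j + 1) (2 * real n) * \<phi> ((2 * real j + 1) / (2 * real n)))
    = b * (\<Sum>j = 1..n. a ^ j * (-1) ^ k * Lerch_Theta c k (2 * real j - 1) (2 * real n) *
        \<phi> ((2 * real n - 2 * real j + 1) / (2 * real n)))"
proof -
  have c: "c \<in> {1, -1}" using a b unfolding c_def by (cases "even n") auto
  have "a ^ (n - j) * Lerch_Theta c k (2 * real (n - j) + 1) (2 * real n)
      = b * (a ^ j * (-1) ^ k * Lerch_Theta c k (2 * real j - 1) (2 * real n))" if j: "j \<in> {1..n}" for j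
  proof -
    have eq: "2 * real (n - j) + 1 = 2 * real n - (2 * real j - 1)" using j by (simp add: of_nat_diff)
    have "Lerch_Theta c k (2 * real (n - j) + 1) (2 * real n)
        = c * (-1) ^ k * Lerch_Theta c k (2 * real j - 1) (2 * real n)"
      unfolding eq using j by (intro Lerch_Theta_reflect c) auto
    moreover have "a ^ (n - j) * c = b * a ^ j"
    proof -
      have "a ^ (n - j) = a ^ n * a ^ j" using a j by (auto simp: minus_one_power_iff)
      moreover have "a ^ n * a ^ n = 1" using a by (auto simp flip: power_mult_distrib)
      ultimately show ?thesis by (simp add: c_def)
    qed
    ultimately show ?thesis by (simp add: mult_ac)
  qed
  then have *: "a ^ (n - j) * Lerch_Theta c k (2 * real (n - j) + 1) (2 * real n) * z
      = b * (a ^ j * (-1) ^ k * Lerch_Theta c k (2 * real j - 1) (2 * real n) * z)" if "j \<in> {1..n}" for j z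
    using that by (simp only: mult.assoc)
  have "(\<Sum>j<n. a ^ j * Lerch_Theta c k (2 * real j + 1) (2 * real n) * \<phi> ((2 * real j + 1) / (2 * real n)))
     = (\<Sum>j = 1..n. a ^ (n - j) * Lerch_Theta c k (2 * real (n - j) + 1) (2 * real n) *
          \<phi> ((2 * real (n - j) + 1) / (2 * real n)))"
    by (rule sum.reindex_bij_witness[of _ "\<lambda>j. n - j" "\<lambda>j. n - j"]) auto
  also have "\<dots> = (\<Sum>j = 1..n. b * (a ^ j * (-1) ^ k * Lerch_Theta c k (2 * real j - 1) (2 * real n) *
          \<phi> ((2 * real (n - j) + 1) / (2 * real n))))"
    by (intro sum.cong refl *)
  finally show ?thesis by (simp add: sum_distrib_left of_nat_diff)
qed

theorem theorem8:
  fixes p q n :: nat and a b :: real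
  assumes "p \<ge> 1" and "q \<ge> 1" and "n \<ge> 1"
    and "a = (-1) ^ (p + q - 1)"
    and "b \<in> {1, -1}"
    and "b = 1 \<Longrightarrow> p \<noteq> 1"
    and "a = 1 \<Longrightarrow> q \<noteq> 1"
  defines "t \<equiv> (\<lambda>k::nat. (a ^ n) ^ k * gen_harm p b k *
                  (\<Sum>j = 1..n. a ^ (j - 1) / (2 * real n * real k + 2 * real j - 1) ^ q))"
  shows "(\<lambda>i. t (Suc i)) sums
    (2 powi (- int q - 1) * (1 - (-1) ^ p) * Lerch_Phi a q (1 / 2) * Lerch_Phi b p 1
     - a ^ (n - 1) * (-2) powi (- int q) * real n ^ p *
         (\<Sum>k = 0..p div 2. real ((p + q - 2 * k - 1) choose (q - 1)) * real n powi (- 2 * int k) *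
            Lerch_Phi (a ^ n * b) (2 * k) 1 * Lerch_Phi a (p + q - 2 * k) (1 / 2))
     - 1 / 2 * a * (- 2 * real n) powi (- int q) *
         (\<Sum>j = 1..n. \<Sum>k = 1..q. real ((p + q - k - 1) choose (p - 1)) * a ^ j * (-1) ^ k *
            Lerch_Theta (a ^ n * b) k (2 * real j - 1) (2 * real n) *
            Lerch_Phi b (p + q - k) ((2 * real n - 2 * real j + 1) / (2 * real n))))"
proof -
  define c where "c = a ^ n * b"
  define g where "g = Lerch_Phi a q (1 / 2) / 2 ^ q"
  define G where "G u = (\<Sum>x<n * u. a ^ x / (2 * real x + 1) ^ q)" for u
  define V where "V = (\<Sum>m. b ^ Suc m / real (Suc m) ^ p * (G (Suc m) - g))"
  define S2 where "S2 = (\<Sum>k = 0..p div 2. real ((p + q - 2 * k - 1) choose (q - 1)) * real n powi (- 2 * int k) *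
            Lerch_Phi c (2 * k) 1 * Lerch_Phi a (p + q - 2 * k) (1 / 2))"
  define S3 where "S3 = (\<Sum>j = 1..n. \<Sum>k = 1..q. real ((p + q - k - 1) choose (p - 1)) * a ^ j * (-1) ^ k *
            Lerch_Theta c k (2 * real j - 1) (2 * real n) *
            Lerch_Phi b (p + q - k) ((2 * real n - 2 * real j + 1) / (2 * real n)))"
  note vals = box_limit_values[OF assms(1-7), folded c_def g_def G_def, folded V_def]
  have a1: "a \<in> {1, -1}" unfolding assms(4) by (cases "even (p + q - 1)") auto
  have bb: "b * b = 1" using assms(5) by auto

  \<comment> \<open>The leading \<open>b\<close> compensates for the exponent \<open>m - 1\<close>
    in \<open>gen_harm\<close>, since the weights of the box sum carry \<open>b ^ m\<close>.\<close>
  have t_eq: "t (Suc i) = b * ((\<Sum>m<Suc i. b ^ Suc m / real (Suc m) ^ p) * (G (Suc (Suc i)) - G (Suc i)))" for i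
  proof -
    have "gen_harm p b (Suc i) = (\<Sum>m<Suc i. b ^ m / real (Suc m) ^ p)"
      unfolding gen_harm_def by (rule sum.reindex_bij_witness[of _ Suc "\<lambda>i. i - 1"]) auto
    also have "\<dots> = b * (\<Sum>m<Suc i. b ^ Suc m / real (Suc m) ^ p)"
      unfolding sum_distrib_left by (intro sum.cong) (simp_all add: bb flip: mult.assoc)
    finally have H: "gen_harm p b (Suc i) = b * (\<Sum>m<Suc i. b ^ Suc m / real (Suc m) ^ p)" .
    \<comment> \<open>The inner sum over \<open>j\<close> runs through the \<open>k\<close>-th block
      of \<open>n\<close> consecutive odd numbers, with \<open>x = n * k + (j - 1)\<close>.\<close>
    have block: "(a ^ n) ^ k * (\<Sum>j = 1..n. a ^ (j - 1) / (2 * real n * real k + 2 * real j - 1) ^ q) = G (Suc k) - G k" for k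
    proof -
      have "G (Suc k) = G k + (\<Sum>x = n * k..<n * k + n. a ^ x / (2 * real x + 1) ^ q)"
        unfolding G_def by (simp add: sum.atLeastLessThan_concat add.commute flip: atLeast0LessThan)
      also have "(\<Sum>x = n * k..<n * k + n. a ^ x / (2 * real x + 1) ^ q)
          = (\<Sum>j = 1..n. (a ^ n) ^ k * (a ^ (j - 1) / (2 * real n * real k + 2 * real j - 1) ^ q))"
      proof (rule sum.reindex_bij_witness[of _ "\<lambda>j. n * k + (j - 1)" "\<lambda>x. x - n * k + 1"])
        fix x assume "x \<in> {n * k..<n * k + n}"
        then obtain d where d: "x = n * k + d" using le_Suc_ex by auto
        show "(a ^ n) ^ k * (a ^ (x - n * k + 1 - 1) / (2 * real n * real k + 2 * real (x - n * k + 1) - 1) ^ q)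
            = a ^ x / (2 * real x + 1) ^ q"
          by (simp add: d power_add algebra_simps flip: power_mult)
      qed auto
      finally show ?thesis by (simp add: sum_distrib_left)
    qed
    show ?thesis unfolding t_def H block[symmetric] by (simp only: mult_ac)
  qed
  have sums: "(\<lambda>i. t (Suc i)) sums (b * - V)"
    unfolding t_eq by (intro sums_mult vals(2))

  have even_part: "(\<Sum>i = 0..p. real ((p + q - i - 1) choose (q - 1)) * (1 + (-1) ^ i) * (c * Lerch_Phi c i 1) *
          (real n ^ (p + q - i) * Lerch_Phi a (p + q - i) (1 / 2))) = 2 * c * real n ^ (p + q) * S2"
  proof -
    have "(\<Sum>i = 0..p. real ((p + q - i - 1) choose (q - 1)) * (1 + (-1) ^ i) * (c * Lerch_Phi c i 1) *
          (real n ^ (p + q - i) * Lerch_Phi a (p + q - i) (1 / 2)))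
      = (\<Sum>i = 0..p. (1 + (-1) ^ i) * (real ((p + q - i - 1) choose (q - 1)) * (c * Lerch_Phi c i 1) *
          (real n ^ (p + q - i) * Lerch_Phi a (p + q - i) (1 / 2))))"
      by (simp only: mult_ac)
    also have "\<dots> = 2 * (\<Sum>k = 0..p div 2. real ((p + q - 2 * k - 1) choose (q - 1)) * (c * Lerch_Phi c (2 * k) 1) *
          (real n ^ (p + q - 2 * k) * Lerch_Phi a (p + q - 2 * k) (1 / 2)))"
      by (rule sum_even_terms)
    also have "(\<Sum>k = 0..p div 2. real ((p + q - 2 * k - 1) choose (q - 1)) * (c * Lerch_Phi c (2 * k) 1) *
          (real n ^ (p + q - 2 * k) * Lerch_Phi a (p + q - 2 * k) (1 / 2))) = c * real n ^ (p + q) * S2"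
      unfolding S2_def sum_distrib_left
    proof (rule sum.cong)
      \<comment> \<open>Since \<open>2 * k <= p\<close>, the natural number subtraction in the
        exponent is exact and the power of \<open>n\<close> can be split.\<close>
      fix k assume "k \<in> {0..p div 2}"
      then have "p + q = (p + q - 2 * k) + 2 * k" by auto
      then have "real n ^ (p + q) = real n ^ (p + q - 2 * k) * real n ^ (2 * k)" by (metis power_add)
      moreover have "real n powi (- 2 * int k) = inverse (real n ^ (2 * k))"
      proof -
        have "- 2 * int k = - int (2 * k)" by simp
        then show ?thesis by (simp only: power_int_minus power_int_of_nat)
      qed
      ultimately have "real n ^ (p + q - 2 * k) = real n ^ (p + q) * real n powi (- 2 * int k)"
        using assms(3) by simp
      then show "real ((p + q - 2 * k - 1) choose (q - 1)) * (c * Lerch_Phi c (2 * k) 1) *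
          (real n ^ (p + q - 2 * k) * Lerch_Phi a (p + q - 2 * k) (1 / 2)) =
          c * real n ^ (p + q) * (real ((p + q - 2 * k - 1) choose (q - 1)) * real n powi (- 2 * int k) *
            Lerch_Phi c (2 * k) 1 * Lerch_Phi a (p + q - 2 * k) (1 / 2))"
        by (simp only: mult_ac)
    qed simp
    finally show ?thesis by (simp only: mult.assoc)
  qed
  have theta_part: "(\<Sum>k = 1..q. real ((p + q - k - 1) choose (p - 1)) *
          (\<Sum>j<n. a ^ j * Lerch_Theta c k (2 * real j + 1) (2 * real n) *
             Lerch_Phi b (p + q - k) ((2 * real j + 1) / (2 * real n)))) = b * S3"
    unfolding c_def reflected_Theta_sum[OF a1 assms(5)] S3_def
    by (subst sum.swap) (simp add: sum_distrib_left mult_ac)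
  have T: "(2 * real n) ^ q * (((-1) ^ p - 1) * (b * Lerch_Phi b p 1 * g) - 2 * V)
      = (-1) ^ p * (2 * c * real n ^ (p + q) * S2 + b * S3)"
    using vals(1) unfolding even_part theta_part .
  define N where "N = (2 * real n) ^ q"
  have N: "N \<noteq> 0" using assms(3) by (simp add: N_def)
  \<comment> \<open>Solve \<open>T\<close> for \<open>V\<close>; the value \<open>b * - V\<close> is
    the sum of the series.\<close>
  have "b * - V = b / 2 * ((-1) ^ p * (2 * c * real n ^ (p + q) * S2 + b * S3) / N
      + (1 - (-1) ^ p) * (b * Lerch_Phi b p 1 * g))"
    unfolding T[symmetric] N_def[symmetric] nonzero_mult_div_cancel_left[OF N] by (simp add: algebra_simps)
  also have "\<dots> = (1 - (-1) ^ p) * Lerch_Phi b p 1 * g / 2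
      + (-1) ^ p * (b * c) * (real n ^ (p + q) / N) * S2 + (-1) ^ p / (2 * N) * S3"
  proof -
    have bbz: "b * (b * z) = z" for z using bb by (simp flip: mult.assoc)
    show ?thesis by (simp add: distrib_left add_divide_distrib bbz mult_ac)
  qed
  also have "real n ^ (p + q) / N = real n ^ p / 2 ^ q"
    using assms(3) by (simp add: N_def power_add power_mult_distrib)
  also have "b * c = a ^ n" using bb by (simp add: c_def mult_ac)
  also have "(1 - (-1) ^ p) * Lerch_Phi b p 1 * g / 2 =
      2 powi (- int q - 1) * (1 - (-1) ^ p) * Lerch_Phi a q (1 / 2) * Lerch_Phi b p 1"
  proof -
    have "(2 :: real) powi (- int q - 1) = 1 / (2 ^ q * 2)"
      by (simp add: power_int_diff power_int_minus inverse_eq_divide)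
    then show ?thesis by (simp add: g_def)
  qed
  finally have main: "b * - V = 2 powi (- int q - 1) * (1 - (-1) ^ p) * Lerch_Phi a q (1 / 2) * Lerch_Phi b p 1
      + (-1) ^ p * a ^ n * (real n ^ p / 2 ^ q) * S2 + (-1) ^ p / (2 * N) * S3" .
  \<comment> \<open>The parity relation trades \<open>(-1) ^ p\<close> for
    \<open>- a * (-1) ^ q\<close>; the sign \<open>(-1) ^ q\<close> is absorbed into the negative
    bases of the integer powers.\<close>
  have sgn: "(-1) ^ p = - (a * (-1) ^ q)"
    unfolding assms(4) by (rule parity_sign[OF assms(1)])
  have neg_powi: "(- x) powi (- int q) = (-1) ^ q / x ^ q" for x :: real
    by (cases "even q") (auto simp: power_int_minus inverse_eq_divide)
  have an: "a ^ n = a * a ^ (n - 1)" using assms(3) by (simp flip: power_Suc)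
  have aa: "a * (a * z) = z" for z using a1 by auto
  have "(-1) ^ p * a ^ n * (real n ^ p / 2 ^ q) = - (a ^ (n - 1) * (-2) powi (- int q) * real n ^ p)"
    unfolding sgn an neg_powi by (simp add: aa mult_ac)
  moreover have "(-1) ^ p / (2 * N) = - (1 / 2 * a * (- 2 * real n) powi (- int q))"
    using neg_powi[of "2 * real n"] unfolding sgn N_def by simp
  ultimately show ?thesis
    using sums unfolding main S2_def S3_def c_def by simp
qed

end
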